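(* Let $j>0$, $R\in(0,1)$, and for $\delta>0$ small let $\rho_\delta$ be the unique function, continuous on $[0,R]$ and vanishing on $(R,1]$, such that $u=j\delta D_0+\rho_\delta$ is a fixed point of $S^{(\delta,-)}_\delta$ with cut point $R^{(\delta)}_{G^{\rm neum}_\delta*u}=R$. Then for every $r\in[0,R]$, $$\lim_{\delta\to0}\rho_\delta(r)=2j(R-r).$$
   Context: $D_0$ is the Dirac delta at $0$. $G^{\rm neum}_t(r,r')$ is the Green function of $\partial_t\rho=\frac12\partial_r^2\rho$ on $[0,1]$ with Neumann boundary conditions, $G^{\rm neum}_t(r,r')=\sum_kG_t(r,r'_k)$ with $G_t(r,r')=e^{-(r-r')^2/2t}/\sqrt{2\pi t}$ and $r'_k$ the images of $r'$ under repeated reflections of $[0,1]$. For $u=cD_0+\rho$, $(G^{\rm neum}_\delta*u)(r)=cG^{\rm neum}_\delta(r,0)+\int_0^1G^{\rm neum}_\delta(r,r')\rho(r')dr'$. The cut-and-paste map is $K^{(\delta)}u=j\delta D_0+\mathbf 1_{r\in[0,R^{(\delta)}_u]}u$ with $\int_{R^{(\delta)}_u}^1u=j\delta$, and $S^{(\delta,-)}_\delta(u)=K^{(\delta)}(G^{\rm neum}_\delta*u)$. Existence and uniqueness of $\rho_\delta$ for small $\delta$ is a result of the paper. *)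

theory Defs
  imports "HOL-Analysis.Analysis"
begin

definition heat_kernel :: "real \<Rightarrow> real \<Rightarrow> real \<Rightarrow> real" where
  "heat_kernel t r r' = exp (- (r - r')\<^sup>2 / (2 * t)) / sqrt (2 * pi * t)"

text \<open>Neumann Green function on [0,1] by the method of images: the images of r'
  under repeated reflections of [0,1] are r' + 2k and -r' + 2k, k integer.\<close>
definition green_neum :: "real \<Rightarrow> real \<Rightarrow> real \<Rightarrow> real" where
  "green_neum t r r' =
     (\<Sum>\<^sub>\<infinity>k\<in>(UNIV::int set).
        heat_kernel t r (r' + 2 * of_int k) + heat_kernel t r (- r' + 2 * of_int k))"

text \<open>Convolution of u = c D_0 + rho with the Neumann Green function.\<close>
definition green_conv :: "real \<Rightarrow> real \<Rightarrow> (real \<Rightarrow> real) \<Rightarrow> real \<Rightarrow> real" where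
  "green_conv t c \<rho> r = c * green_neum t r 0 + integral {0..1} (\<lambda>r'. green_neum t r r' * \<rho> r')"

text \<open>rho is the density of a fixed point u = j delta D_0 + rho of S^{(delta,-)}_delta
  with cut point R: rho continuous on [0,R], zero on (R,1], and
  K^{(delta)}(G_delta * u) = u, where the cut point of v = G_delta * u is R,
  i.e. the integral of v over [R,1] equals j delta, and the restriction of v to [0,R]
  equals rho.\<close>
definition is_fixed_profile :: "real \<Rightarrow> real \<Rightarrow> real \<Rightarrow> (real \<Rightarrow> real) \<Rightarrow> bool" where
  "is_fixed_profile j R \<delta> \<rho> \<longleftrightarrow>
     continuous_on {0..R} \<rho> \<and>
     (\<forall>r\<in>{R<..1}. \<rho> r = 0) \<and>
     integral {R..1} (green_conv \<delta> (j * \<delta>) \<rho>) = j * \<delta> \<and>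
     (\<forall>r\<in>{0..R}. \<rho> r = green_conv \<delta> (j * \<delta>) \<rho> r)"

end

theory Submission
  imports Defs "HOL-Probability.Characteristic_Functions"
begin

text \<open>
  In the basis cos (k pi x), the Neumann kernel at time delta is diagonal with entries
  exp (- a_k delta), where a_k = (k pi)^2 / 2. Let u = G_delta * (j delta D_0 + rho_delta), so that
  rho_delta = u on [0,R] and delta v := u on [R,1] is the mass that is cut. Comparing coefficients gives,
  for k > 0, that u has coefficient (j - v_k) delta / (exp (a_k delta) - 1). A minimum argument shows
  rho_delta >= 0, so v >= 0 has mass j, and hence these coefficients are dominated by 2 j / a_k.
  Therefore u minus its mean is bounded uniformly in delta; as the integral of u over [R,1] is j delta, the mean
  is bounded as well. Gaussian decay of the kernel off the diagonal then makes u = o(delta) away from [0,R], so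
  v converges to j D_R. By dominated convergence u minus its mean tends to the cosine series with
  coefficients j (1 - cos (k pi R)) / a_k, which is that of 2 j max (R - r) 0 minus its mean. Finally u(1)
  tends to 0, which identifies the limit of the mean.
\<close>

subsection \<open>Cosine series on the unit interval\<close>

definition cos_mode :: "nat \<Rightarrow> real \<Rightarrow> real" where
  "cos_mode k x = cos (real k * pi * x)"

text \<open>The reciprocal of the squared L2 norm of \<open>cos_mode k\<close> on [0,1], that is,
  the factor that turns an inner product with the mode into its Fourier coefficient.\<close>

definition cos_weight :: "nat \<Rightarrow> real" where
  "cos_weight k = (if k = 0 then 1 else 2)"

text \<open>The eigenvalue of -(1/2) d^2/dx^2 on the mode, so that the heat flow multiplies
  \<open>cos_mode k\<close> by \<open>exp (- (cos_eig k * t))\<close>.\<close>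

definition cos_eig :: "nat \<Rightarrow> real" where
  "cos_eig k = (real k * pi)\<^sup>2 / 2"

lemma cos_mode_0 [simp]: "cos_mode 0 x = 1"
  by (simp add: cos_mode_def)

lemma abs_cos_mode_le_1: "\<bar>cos_mode k x\<bar> \<le> 1"
  by (simp add: cos_mode_def)

lemma cos_weight_pos [simp]: "cos_weight k > 0"
  by (simp add: cos_weight_def)

lemma continuous_on_cos_mode [continuous_intros]:
  fixes f :: "'a::t2_space \<Rightarrow> real"
  shows "continuous_on S f \<Longrightarrow> continuous_on S (\<lambda>x. cos_mode k (f x))"
  unfolding cos_mode_def by (auto intro!: continuous_intros)

lemma abs_cos_mode_diff_le: "\<bar>cos_mode k x - cos_mode k y\<bar> \<le> real k * pi * \<bar>x - y\<bar>"
proof -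
  have "\<bar>cos a - cos b\<bar> \<le> \<bar>a - b\<bar>" for a b :: real
  proof -
    have "\<bar>cos a - cos b\<bar> = 2 * \<bar>sin ((a + b) / 2)\<bar> * \<bar>sin ((b - a) / 2)\<bar>"
      by (simp add: cos_diff_cos abs_mult)
    also have "\<dots> \<le> 2 * 1 * \<bar>(b - a) / 2\<bar>"
      using abs_sin_x_le_abs_x[of "(b - a) / 2"] by (intro mult_mono) auto
    finally show ?thesis by (simp add: abs_minus_commute)
  qed
  from this[of "real k * pi * x" "real k * pi * y"] show ?thesis
    unfolding cos_mode_def by (simp only: right_diff_distrib[symmetric] abs_mult) simp
qed

lemma cos_eig_pos: "k > 0 \<Longrightarrow> cos_eig k > 0"
  by (simp add: cos_eig_def)

lemma cos_eig_0 [simp]: "cos_eig 0 = 0"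
  by (simp add: cos_eig_def)

lemma summable_inverse_cos_eig: "summable (\<lambda>k. 1 / cos_eig (Suc k))"
proof -
  have "summable (\<lambda>k. 2 / pi\<^sup>2 * inverse (real (Suc k) ^ 2))"
    by (intro summable_mult summable_Suc_iff[THEN iffD2] inverse_power_summable) auto
  moreover have "2 / pi\<^sup>2 * inverse (real (Suc k) ^ 2) = 1 / cos_eig (Suc k)" for k
    unfolding cos_eig_def power_mult_distrib by (simp add: inverse_eq_divide mult.commute del: of_nat_Suc)
  ultimately show ?thesis by (simp only:)
qed

text \<open>Integer frequencies cover both terms of the product-to-sum formula, including the
  difference of two indices when it is negative.\<close>

lemma has_integral_cos_pi_int:
  fixes n :: int
  shows "((\<lambda>x. cos (of_int n * pi * x)) has_integral (if n = 0 then 1 else 0)) {0..1::real}"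
proof (cases "n = 0")
  case True
  then show ?thesis
    using has_integral_const_real[of "1::real" 0 1] by simp
next
  case False
  have "((\<lambda>x. cos (of_int n * pi * x)) has_integral
          (sin (of_int n * pi * 1) / (of_int n * pi) - sin (of_int n * pi * 0) / (of_int n * pi))) {0..1::real}"
    by (rule fundamental_theorem_of_calculus)
       (use False in \<open>auto intro!: derivative_eq_intros
          simp: has_real_derivative_iff_has_vector_derivative[symmetric]\<close>)
  then show ?thesis
    using False sin_integer_2pi sin_zero_iff_int2[of "of_int n * pi"] by auto
qed

lemma cos_mode_mult:
  "cos_mode m x * cos_mode n x =
     (cos (of_int (int m - int n) * pi * x) + cos (of_int (int m + int n) * pi * x)) / 2"
  unfolding cos_mode_def by (simp add: cos_times_cos algebra_simps)

lemma has_integral_cos_mode_mult: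
  "((\<lambda>x. cos_mode m x * cos_mode n x) has_integral (if m = n then 1 / cos_weight n else 0)) {0..1}"
proof -
  have "((\<lambda>x. (cos (of_int (int m - int n) * pi * x) + cos (of_int (int m + int n) * pi * x)) * (1/2))
     has_integral ((if int m - int n = 0 then 1 else 0) + (if int m + int n = 0 then 1 else 0)) * (1/2)) {0..1::real}"
    by (intro has_integral_mult_left has_integral_add has_integral_cos_pi_int)
  moreover have "int m + int n = 0 \<longleftrightarrow> m = 0 \<and> n = 0" by auto
  ultimately show ?thesis
    unfolding cos_mode_mult by (auto simp: cos_weight_def split: if_splits)
qed

lemma uniform_limit_cos_series:
  assumes "summable (\<lambda>k. \<bar>c k\<bar>)"
  shows "uniform_limit UNIV (\<lambda>n x. \<Sum>k<n. c k * cos_mode k x) (\<lambda>x. \<Sum>k. c k * cos_mode k x) sequentially"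
  by (rule Weierstrass_m_test[OF _ assms])
     (auto simp: abs_mult intro!: mult_left_le abs_cos_mode_le_1)

lemma continuous_on_cos_series:
  assumes "summable (\<lambda>k. \<bar>c k\<bar>)"
  shows "continuous_on S (\<lambda>x. \<Sum>k. c k * cos_mode k x)"
proof -
  have "continuous_on UNIV (\<lambda>x. \<Sum>k. c k * cos_mode k x)"
    by (rule uniform_limit_theorem[OF _ uniform_limit_cos_series[OF assms]])
       (auto intro!: always_eventually continuous_intros)
  then show ?thesis
    using continuous_on_subset by blast
qed

lemma summable_cos_series:
  assumes "summable (\<lambda>k. \<bar>c k\<bar>)"
  shows "summable (\<lambda>k. c k * cos_mode k x)"
  by (rule summable_comparison_test[OF _ assms])
     (auto simp: abs_mult intro!: exI[of _ 0] mult_left_le abs_cos_mode_le_1)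

text \<open>By the M-test the partial sums converge uniformly, and they still do after
  multiplication by the bounded function \<open>g\<close>. This permits termwise
  integration.\<close>

lemma sums_integral_cos_series:
  assumes c: "summable (\<lambda>k. \<bar>c k\<bar>)" and g: "continuous_on {a..b} g"
  shows "(\<lambda>k. c k * integral {a..b} (\<lambda>x. cos_mode k x * g x)) sums
           integral {a..b} (\<lambda>x. (\<Sum>k. c k * cos_mode k x) * g x)"
proof -
  have bdd: "bounded (g ` {a..b})"
    using compact_continuous_image[OF g] compact_imp_bounded by blast
  have lim: "uniform_limit {a..b} (\<lambda>n x. (\<Sum>k<n. c k * cos_mode k x) * g x)
          (\<lambda>x. (\<Sum>k. c k * cos_mode k x) * g x) sequentially"
  proof (intro uniform_lim_mult uniform_limit_const)
    show "uniform_limit {a..b} (\<lambda>n x. \<Sum>k<n. c k * cos_mode k x) (\<lambda>x. \<Sum>k. c k * cos_mode k x) sequentially"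
      by (rule uniform_limit_on_subset[OF uniform_limit_cos_series[OF c]]) auto
    show "bounded ((\<lambda>x. \<Sum>k. c k * cos_mode k x) ` {a..b})"
      using compact_continuous_image[OF continuous_on_cos_series[OF c]] compact_imp_bounded by blast
  qed (rule bdd)
  obtain I J where IJ: "\<And>n. ((\<lambda>x. (\<Sum>k<n. c k * cos_mode k x) * g x) has_integral I n) {a..b}"
      "((\<lambda>x. (\<Sum>k. c k * cos_mode k x) * g x) has_integral J) {a..b}" "I \<longlonglongrightarrow> J"
    by (rule uniform_limit_integral[OF lim]) (auto intro!: continuous_intros g)
  have "I n = (\<Sum>k<n. c k * integral {a..b} (\<lambda>x. cos_mode k x * g x))" for n
  proof -
    have int: "(\<lambda>x. cos_mode k x * g x) integrable_on {a..b}" for k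
      by (intro integrable_continuous_interval continuous_intros g)
    have "I n = integral {a..b} (\<lambda>x. \<Sum>k<n. c k * (cos_mode k x * g x))"
      using integral_unique[OF IJ(1)[of n]] by (simp add: sum_distrib_right mult.assoc)
    also have "\<dots> = (\<Sum>k<n. c k * integral {a..b} (\<lambda>x. cos_mode k x * g x))"
      by (subst integral_sum) (auto intro!: integrable_on_mult_right int)
    finally show ?thesis .
  qed
  then have "I = (\<lambda>n. \<Sum>k<n. c k * integral {a..b} (\<lambda>x. cos_mode k x * g x))" by auto
  then show ?thesis
    using IJ(2,3) unfolding sums_def by (simp add: integral_unique)
qed

lemma integral_cos_series_cos_mode:
  assumes "summable (\<lambda>k. \<bar>c k\<bar>)"
  shows "integral {0..1} (\<lambda>x. (\<Sum>k. c k * cos_mode k x) * cos_mode m x) = c m / cos_weight m"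
proof -
  have "(\<lambda>k. c k * integral {0..1} (\<lambda>x. cos_mode k x * cos_mode m x)) sums
           integral {0..1} (\<lambda>x. (\<Sum>k. c k * cos_mode k x) * cos_mode m x)"
    by (intro sums_integral_cos_series assms continuous_intros)
  then have "(\<lambda>k. if k = m then c k / cos_weight m else 0) sums
           integral {0..1} (\<lambda>x. (\<Sum>k. c k * cos_mode k x) * cos_mode m x)"
    by (rule sums_cong[THEN iffD1, rotated])
       (auto simp: integral_unique[OF has_integral_cos_mode_mult])
  then show ?thesis
    using sums_unique2[OF _ sums_single[of m "\<lambda>k. c k / cos_weight m"]] by blast
qed

section \<open>Completeness of the cosine system on [0,1]\<close>

inductive cos_poly :: "(real \<Rightarrow> real) \<Rightarrow> bool" where
  mode: "cos_poly (\<lambda>x. c * cos_mode k x)"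
| add: "cos_poly f \<Longrightarrow> cos_poly g \<Longrightarrow> cos_poly (\<lambda>x. f x + g x)"

lemma continuous_on_cos_poly: "cos_poly f \<Longrightarrow> continuous_on S f"
  by (induction rule: cos_poly.induct) (auto intro!: continuous_intros)

text \<open>The product-to-sum formula keeps products of modes in the span. The span is therefore an
  algebra, as Stone-Weierstrass requires.\<close>

lemma cos_poly_mult_mode: "cos_poly g \<Longrightarrow> cos_poly (\<lambda>x. c * cos_mode k x * g x)"
proof (induction rule: cos_poly.induct)
  case (mode d m)
  \<comment> \<open>This is the absolute difference of \<open>k\<close> and \<open>m\<close>; the
    case split avoids truncated subtraction, and evenness of cosine makes the sign
    immaterial.\<close>
  define l where "l = (if k \<ge> m then k - m else m - k)"
  have *: "cos_mode k x * cos_mode m x = (cos_mode l x + cos_mode (k + m) x) / 2" for x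
  proof -
    have "cos (of_int (int k - int m) * pi * x) = cos_mode l x"
    proof (cases "k \<ge> m")
      case True
      then show ?thesis by (simp add: cos_mode_def l_def of_nat_diff)
    next
      case False
      then have "of_int (int k - int m) * pi * x = - (real (m - k) * pi * x)"
        by (simp add: of_nat_diff algebra_simps)
      then have "cos (of_int (int k - int m) * pi * x) = cos (real (m - k) * pi * x)"
        by (metis cos_minus)
      then show ?thesis using False by (simp add: cos_mode_def l_def)
    qed
    then show ?thesis
      unfolding cos_mode_mult by (simp add: cos_mode_def algebra_simps)
  qed
  have "(\<lambda>x. c * cos_mode k x * (d * cos_mode m x)) =
      (\<lambda>x. (c * d / 2) * cos_mode l x + (c * d / 2) * cos_mode (k + m) x)"
    using * by (auto simp: fun_eq_iff field_simps)
  then show ?case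
    by (simp only:) (intro cos_poly.intros)
next
  case (add f g)
  then show ?case
    using cos_poly.add by (simp add: distrib_left)
qed

lemma cos_poly_mult: "cos_poly f \<Longrightarrow> cos_poly g \<Longrightarrow> cos_poly (\<lambda>x. f x * g x)"
proof (induction rule: cos_poly.induct)
  case (add f1 f2)
  then show ?case
    using cos_poly.add by (simp add: distrib_right)
qed (simp add: cos_poly_mult_mode)

lemma integral_cos_poly_eq_0:
  assumes "cos_poly g" and h: "continuous_on {0..1} h"
    and "\<And>k. integral {0..1} (\<lambda>x. h x * cos_mode k x) = 0"
  shows "integral {0..1} (\<lambda>x. h x * g x) = 0"
  using assms(1)
proof (induction rule: cos_poly.induct)
  case (mode c k)
  then show ?case
    using assms(3)[of k] by (simp add: mult.left_commute[of _ c])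
next
  case (add f g)
  then show ?case
    by (simp add: distrib_left integral_add integrable_continuous_interval
        continuous_on_mult h continuous_on_cos_poly)
qed

text \<open>By Stone-Weierstrass, with cos (pi x) separating points, \<open>h\<close> lies uniformly
  within \<open>d\<close> of some cosine polynomial \<open>g\<close>. Since \<open>h\<close> is
  orthogonal to \<open>g\<close>, the integral of h^2 equals that of h (h - g), which is at most
  \<open>d\<close> times the integral of |h|. So h^2 has integral 0, and continuity gives h =
  0.\<close>

lemma cos_coeffs_eq_0_imp_eq_0:
  assumes h: "continuous_on {0..1} h"
    and coeff: "\<And>k. integral {0..1} (\<lambda>x. h x * cos_mode k x) = 0"
    and x: "x \<in> {0..1}"
  shows "h x = 0"
proof -
  let ?A = "integral {0..1} (\<lambda>x. h x * h x)" and ?B = "integral {0..1} (\<lambda>x. \<bar>h x\<bar>)"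
  have B: "?B \<ge> 0"
    by (intro integral_nonneg integrable_continuous_interval continuous_intros h) auto
  have "?A \<le> 0 + e" if "e > 0" for e
  proof -
    \<comment> \<open>The summand 1 keeps the denominator positive even when the integral of |h| is
      0, and still gives \<open>?B * d\<close> \<le> e.\<close>
    define d where "d = e / (1 + ?B)"
    have d: "d > 0" using that B by (simp add: d_def)
    have "\<exists>g. cos_poly g \<and> (\<forall>x\<in>{0..1}. \<bar>h x - g x\<bar> < d)"
    proof (rule Stone_Weierstrass_HOL)
      show "cos_poly (\<lambda>x. c)" for c
        using cos_poly.mode[of c 0] by simp
      show "\<exists>f. cos_poly f \<and> f x \<noteq> f y" if "x \<in> {0..1} \<and> y \<in> {0..1} \<and> x \<noteq> y" for x y
      proof -
        have "cos (pi * x) \<noteq> cos (pi * y)"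
          using that cos_inj_pi[of "pi * x" "pi * y"] by auto
        then show ?thesis
          using cos_poly.mode[of 1 1] by (intro exI[of _ "\<lambda>x. 1 * cos_mode 1 x"]) (auto simp: cos_mode_def)
      qed
    qed (use h d in \<open>auto intro: continuous_on_cos_poly cos_poly.add cos_poly_mult\<close>)
    then obtain g where g: "cos_poly g" "\<And>x. x \<in> {0..1} \<Longrightarrow> \<bar>h x - g x\<bar> < d"
      by blast
    have cg: "continuous_on {0..1} g" by (rule continuous_on_cos_poly[OF g(1)])
    have "?A = integral {0..1} (\<lambda>x. h x * (h x - g x)) + integral {0..1} (\<lambda>x. h x * g x)"
      by (subst integral_add[symmetric])
         (auto intro!: integrable_continuous_interval continuous_intros h cg simp: algebra_simps)
    also have "\<dots> = integral {0..1} (\<lambda>x. h x * (h x - g x))"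
      using integral_cos_poly_eq_0[OF g(1) h coeff] by simp
    also have "\<dots> \<le> integral {0..1} (\<lambda>x. \<bar>h x\<bar> * d)"
    proof (rule integral_le)
      show "h x * (h x - g x) \<le> \<bar>h x\<bar> * d" if "x \<in> {0..1}" for x
      proof -
        have "h x * (h x - g x) \<le> \<bar>h x\<bar> * \<bar>h x - g x\<bar>"
          by (metis abs_ge_self abs_mult)
        also have "\<dots> \<le> \<bar>h x\<bar> * d"
          using g(2)[OF that] by (intro mult_left_mono) auto
        finally show ?thesis .
      qed
    qed (intro integrable_continuous_interval continuous_intros h cg)+
    also have "\<dots> = ?B * d" by simp
    also have "\<dots> \<le> (1 + ?B) * d" using d by (intro mult_right_mono) auto
    also have "\<dots> = e" using B by (simp add: d_def)
    finally show ?thesis by simp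
  qed
  then have "?A \<le> 0" by (rule field_le_epsilon)
  moreover have "?A \<ge> 0"
    by (intro integral_nonneg integrable_continuous_interval continuous_intros h) auto
  ultimately have "?A = 0" by simp
  moreover have "((\<lambda>x. h x * h x) has_integral ?A) {0..1}"
    by (intro integrable_integral integrable_continuous_interval continuous_intros h)
  ultimately have "((\<lambda>x. h x * h x) has_integral 0) (cbox 0 1)" by simp
  then have "h x * h x = 0"
    by (rule has_integral_0_cbox_imp_0[rotated 2])
       (use x h in \<open>auto intro!: continuous_intros\<close>)
  then show ?thesis by simp
qed

text \<open>Absolute summability makes the series a continuous function with the same cosine
  coefficients as \<open>f\<close>; completeness applied to the difference identifies the two
  pointwise.\<close>

lemma cos_series_expansion:
  assumes f: "continuous_on {0..1} f"
    and coeff: "\<And>k. integral {0..1} (\<lambda>x. f x * cos_mode k x) = c k"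
    and c: "summable (\<lambda>k. \<bar>c k\<bar>)"
    and x: "x \<in> {0..1}"
  shows "f x = (\<Sum>k. cos_weight k * c k * cos_mode k x)"
proof -
  let ?c = "\<lambda>k. cos_weight k * c k"
  let ?S = "\<lambda>x. \<Sum>k. cos_weight k * c k * cos_mode k x"
  have sc: "summable (\<lambda>k. \<bar>?c k\<bar>)"
    by (rule summable_comparison_test'[OF summable_mult[OF c, of 2], of 0])
       (auto simp: cos_weight_def abs_mult)
  have cS: "continuous_on {0..1} ?S" by (rule continuous_on_cos_series[OF sc])
  have "f x - ?S x = 0"
  proof (rule cos_coeffs_eq_0_imp_eq_0[OF _ _ x])
    show "continuous_on {0..1} (\<lambda>x. f x - ?S x)"
      by (intro continuous_intros f cS)
    show "integral {0..1} (\<lambda>x. (f x - ?S x) * cos_mode k x) = 0" for k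
    proof -
      have "integral {0..1} (\<lambda>x. (f x - ?S x) * cos_mode k x)
          = integral {0..1} (\<lambda>x. f x * cos_mode k x) - integral {0..1} (\<lambda>x. ?S x * cos_mode k x)"
        unfolding left_diff_distrib
        by (intro integral_diff integrable_continuous_interval continuous_intros f cS)
      also have "\<dots> = 0"
        unfolding integral_cos_series_cos_mode[OF sc] coeff
        using less_imp_neq[OF cos_weight_pos[of k]] by simp
      finally show ?thesis .
    qed
  qed
  then show ?thesis by simp
qed

section \<open>Cosine series of the limit profile\<close>

lemma tent_coeff:
  assumes "0 < R" "R < 1"
  shows "integral {0..1} (\<lambda>x. 2 * max (R - x) 0 * cos_mode k x)
           = (if k = 0 then R\<^sup>2 else (1 - cos_mode k R) / cos_eig k)"
proof -
  have "integral {0..1} (\<lambda>x. 2 * max (R - x) 0 * cos_mode k x)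
      = integral {0..1} (\<lambda>x. if x \<in> {0..R} then 2 * (R - x) * cos_mode k x else 0)"
    by (rule integral_cong) auto
  also have "\<dots> = integral ({0..R} \<inter> {0..1}) (\<lambda>x. 2 * (R - x) * cos_mode k x)"
    by (rule Henstock_Kurzweil_Integration.integral_restrict_Int)
  also have "{0..R} \<inter> {0..1} = {0..R}" using assms by auto
  also have "integral {0..R} (\<lambda>x. 2 * (R - x) * cos_mode k x)
      = (if k = 0 then R\<^sup>2 else (1 - cos_mode k R) / cos_eig k)"
  \<comment> \<open>The mean is separate: at k = 0 the general formula reads 0 / 0, which evaluates
    to 0 instead of R^2.\<close>
  proof (cases "k = 0")
    case True
    have "((\<lambda>x. 2 * (R - x)) has_integral (2 * R * R - R\<^sup>2) - (2 * R * 0 - 0\<^sup>2)) {0..R}"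
      by (rule fundamental_theorem_of_calculus)
         (use assms in \<open>auto intro!: derivative_eq_intros
            simp: has_real_derivative_iff_has_vector_derivative[symmetric] algebra_simps\<close>)
    from integral_unique[OF this] show ?thesis
      using True by (simp add: power2_eq_square)
  next
    case False
    define \<kappa> where "\<kappa> = real k * pi"
    have \<kappa>: "\<kappa> \<noteq> 0" using False by (simp add: \<kappa>_def)
    define a where "a = 1 / \<kappa>"
    have a: "\<kappa> * a = 1" using \<kappa> by (simp add: a_def)
    \<comment> \<open>An antiderivative found by integrating by parts. Writing \<open>a\<close> for
      the inverse frequency reduces the derivative check to polynomial algebra with
      \<open>\<kappa> * a = 1\<close>.\<close>
    let ?F = "\<lambda>x. 2 * (R - x) * sin (\<kappa> * x) * a - 2 * cos (\<kappa> * x) * a\<^sup>2"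
    have "((\<lambda>x. 2 * (R - x) * cos (\<kappa> * x)) has_integral ?F R - ?F 0) {0..R}"
    proof (rule fundamental_theorem_of_calculus)
      show "(?F has_vector_derivative 2 * (R - x) * cos (\<kappa> * x)) (at x within {0..R})" for x
        unfolding has_real_derivative_iff_has_vector_derivative[symmetric]
      proof (rule DERIV_cong)
        show "(?F has_real_derivative (2 * (R - x) * (cos (\<kappa> * x) * \<kappa>) + - 2 * sin (\<kappa> * x)) * a
                + 2 * (sin (\<kappa> * x) * \<kappa>) * a\<^sup>2) (at x within {0..R})"
          by (rule derivative_eq_intros refl)+ simp
        have "(2 * (R - x) * (cos (\<kappa> * x) * \<kappa>) + - 2 * sin (\<kappa> * x)) * a + 2 * (sin (\<kappa> * x) * \<kappa>) * a\<^sup>2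
            = 2 * (R - x) * cos (\<kappa> * x) * (\<kappa> * a) - 2 * sin (\<kappa> * x) * a + 2 * sin (\<kappa> * x) * a * (\<kappa> * a)"
          by (simp add: algebra_simps power2_eq_square)
        then show "(2 * (R - x) * (cos (\<kappa> * x) * \<kappa>) + - 2 * sin (\<kappa> * x)) * a + 2 * (sin (\<kappa> * x) * \<kappa>) * a\<^sup>2
            = 2 * (R - x) * cos (\<kappa> * x)"
          by (simp add: a)
      qed
    qed (use assms in simp)
    from integral_unique[OF this] show ?thesis
      using False by (simp add: cos_mode_def cos_eig_def a_def \<kappa>_def power_divide diff_divide_distrib)
  qed
  finally show ?thesis .
qed

lemma summable_tent_coeff: "summable (\<lambda>k. \<bar>(1 - cos_mode (Suc k) R) / cos_eig (Suc k)\<bar>)"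
proof (rule summable_comparison_test'[OF summable_mult[OF summable_inverse_cos_eig, of 2], of 0])
  fix k
  have "\<bar>1 - cos_mode (Suc k) R\<bar> \<le> 2"
    using abs_cos_mode_le_1[of "Suc k" R] by linarith
  then show "norm \<bar>(1 - cos_mode (Suc k) R) / cos_eig (Suc k)\<bar> \<le> 2 * (1 / cos_eig (Suc k))"
    using cos_eig_pos[of "Suc k"] by (simp add: abs_divide divide_right_mono)
qed

text \<open>Starting at \<open>Suc k\<close> drops the mean R^2 of the tent. Multiplied by
  \<open>j\<close>, the remaining series is what u minus its mean will be shown to approach.\<close>

lemma tent_cos_series:
  assumes R: "0 < R" "R < 1" and x: "x \<in> {0..1}"
  shows "(\<lambda>k. 2 * ((1 - cos_mode (Suc k) R) / cos_eig (Suc k)) * cos_mode (Suc k) x) sums (2 * max (R - x) 0 - R\<^sup>2)"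
proof -
  define c where "c k = (if k = 0 then R\<^sup>2 else (1 - cos_mode k R) / cos_eig k)" for k
  have "summable (\<lambda>k. \<bar>c (Suc k)\<bar>)"
    using summable_tent_coeff by (simp add: c_def)
  then have sc: "summable (\<lambda>k. \<bar>c k\<bar>)"
    by (rule summable_Suc_iff[of "\<lambda>k. \<bar>c k\<bar>", THEN iffD1])
  have sc': "summable (\<lambda>k. \<bar>cos_weight k * c k\<bar>)"
    by (rule summable_comparison_test'[OF summable_mult[OF sc, of 2], of 0])
       (auto simp: cos_weight_def abs_mult)
  have "2 * max (R - x) 0 = (\<Sum>k. cos_weight k * c k * cos_mode k x)"
  proof (rule cos_series_expansion[OF _ _ sc x])
    show "continuous_on {0..1} (\<lambda>x. 2 * max (R - x) 0)"
      by (intro continuous_intros)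
    show "integral {0..1} (\<lambda>x. 2 * max (R - x) 0 * cos_mode k x) = c k" for k
      unfolding c_def by (rule tent_coeff[OF R])
  qed
  then have "(\<lambda>k. cos_weight k * c k * cos_mode k x) sums (2 * max (R - x) 0)"
    using summable_sums[OF summable_cos_series[OF sc', of x]] by simp
  then have "(\<lambda>k. cos_weight (Suc k) * c (Suc k) * cos_mode (Suc k) x) sums (2 * max (R - x) 0 - cos_weight 0 * c 0 * cos_mode 0 x)"
    by (subst sums_Suc_iff) simp
  then show ?thesis
    by (simp add: cos_weight_def c_def)
qed

subsection \<open>The Neumann kernel\<close>

lemma continuous_on_heat_kernel [continuous_intros]:
  fixes f g :: "'a::t2_space \<Rightarrow> real"
  assumes "continuous_on S f" "continuous_on S g" "t > 0"
  shows "continuous_on S (\<lambda>y. heat_kernel t (f y) (g y))"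
  unfolding heat_kernel_def using assms by (auto intro!: continuous_intros)

lemma heat_kernel_pos: "t > 0 \<Longrightarrow> heat_kernel t x y > 0"
  by (simp add: heat_kernel_def)

lemma heat_kernel_le_peak: "t > 0 \<Longrightarrow> heat_kernel t x y \<le> 1 / sqrt (2 * pi * t)"
  by (simp add: heat_kernel_def divide_right_mono)

text \<open>The inequality exp w >= w^2 / 2 replaces the Gaussian by a power. The resulting d^(-4)
  is summable over the images, and t^2 / sqrt t is still o(t), which is the rate needed
  later.\<close>

lemma heat_kernel_decay:
  assumes t: "t > 0" and d: "0 < d" "d \<le> \<bar>x - y\<bar>"
  shows "heat_kernel t x y \<le> 8 * t\<^sup>2 / sqrt (2 * pi * t) / d ^ 4"
proof -
  define w where "w = d\<^sup>2 / (2 * t)"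
  have w: "w > 0" using t d by (simp add: w_def)
  have "d\<^sup>2 \<le> (x - y)\<^sup>2" using d by (metis abs_le_square_iff abs_of_pos)
  then have "exp (- (x - y)\<^sup>2 / (2 * t)) \<le> exp (- w)"
    using t by (simp add: w_def divide_right_mono)
  also have "\<dots> \<le> 2 / w\<^sup>2"
  proof -
    have "w\<^sup>2 / 2 \<le> exp w"
      using exp_lower_Taylor_quadratic[of w] w by simp
    then show ?thesis
      using w by (simp add: exp_minus field_simps)
  qed
  also have "2 / w\<^sup>2 = 8 * t\<^sup>2 / d ^ 4"
    using t d by (simp add: w_def field_simps power2_eq_square power4_eq_xxxx)
  finally have "exp (- (x - y)\<^sup>2 / (2 * t)) / sqrt (2 * pi * t) \<le> 8 * t\<^sup>2 / d ^ 4 / sqrt (2 * pi * t)"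
    using t by (intro divide_right_mono) auto
  then show ?thesis
    by (simp add: heat_kernel_def mult.commute)
qed

text \<open>The kernel is the normal density of mean \<open>x\<close> and variance \<open>t\<close>.
  Substituting z = x + sqrt t * w and expanding the cosine of the sum leaves the characteristic
  function of the standard normal law: its real part gives the exponential factor, and its imaginary
  part vanishes.\<close>

lemma lborel_integral_heat_kernel_cos_mode:
  assumes t: "t > 0"
  shows "integrable lborel (\<lambda>z. heat_kernel t x z * cos_mode m z)"
    and "(LINT z|lborel. heat_kernel t x z * cos_mode m z) = exp (- (cos_eig m * t)) * cos_mode m x"
proof -
  have hk: "heat_kernel t x z = normal_density x (sqrt t) z" for z
    using t by (simp add: heat_kernel_def normal_density_def power2_commute)
  show int: "integrable lborel (\<lambda>z. heat_kernel t x z * cos_mode m z)"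
    unfolding hk
  proof (rule Bochner_Integration.integrable_bound)
    show "integrable lborel (normal_density x (sqrt t))"
      using t by simp
    show "AE z in lborel. norm (normal_density x (sqrt t) z * cos_mode m z) \<le> norm (normal_density x (sqrt t) z)"
      by (auto simp: abs_mult intro!: mult_left_le abs_cos_mode_le_1)
    show "(\<lambda>z. normal_density x (sqrt t) z * cos_mode m z) \<in> borel_measurable lborel"
      unfolding cos_mode_def by measurable
  qed
  \<comment> \<open>The frequency of the mode after rescaling, chosen so that s^2 / 2 =
    \<open>cos_eig m * t\<close>.\<close>
  define s where "s = real m * pi * sqrt t"
  have ci: "integrable lborel (\<lambda>w. std_normal_density w *\<^sub>R iexp (s * w))"
  proof (rule Bochner_Integration.integrable_bound)
    show "integrable lborel std_normal_density" by simp
  qed (auto simp: norm_exp_i_times)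
  have "complex_of_real (exp (- (s\<^sup>2) / 2)) = (CLINT w|lborel. std_normal_density w *\<^sub>R iexp (s * w))"
    using fun_cong[OF char_std_normal_distribution, of s]
    by (simp add: char_def integral_density del: of_real_mult)
  then have c: "(CLINT w|lborel. std_normal_density w *\<^sub>R iexp (s * w)) = complex_of_real (exp (- (s\<^sup>2) / 2))" ..
  have cosI: "(LINT w|lborel. std_normal_density w * cos (s * w)) = exp (- (s\<^sup>2) / 2)"
    and cosi: "integrable lborel (\<lambda>w. std_normal_density w * cos (s * w))"
    using integral_Re[OF ci] integrable_Re[OF ci] c by (simp_all add: Re_exp)
  have sinI: "(LINT w|lborel. std_normal_density w * sin (s * w)) = 0"
    and sini: "integrable lborel (\<lambda>w. std_normal_density w * sin (s * w))"
    using integral_Im[OF ci] integrable_Im[OF ci] c by (simp_all add: Im_exp)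
  have "(LINT z|lborel. heat_kernel t x z * cos_mode m z) =
      \<bar>sqrt t\<bar> *\<^sub>R (LINT w|lborel. heat_kernel t x (x + sqrt t * w) * cos_mode m (x + sqrt t * w))"
    using t by (intro lborel_integral_real_affine) auto
  also have "\<dots> = (LINT w|lborel. sqrt t * (heat_kernel t x (x + sqrt t * w) * cos_mode m (x + sqrt t * w)))"
    using t by simp
  also have "\<dots> = (LINT w|lborel. cos_mode m x * (std_normal_density w * cos (s * w))
                    - sin (real m * pi * x) * (std_normal_density w * sin (s * w)))"
  proof (rule Bochner_Integration.integral_cong[OF refl])
    fix w :: real
    have 1: "sqrt t * heat_kernel t x (x + sqrt t * w) = std_normal_density w"
      using t by (simp add: heat_kernel_def std_normal_density_def real_sqrt_mult power_mult_distrib)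
    have 2: "cos_mode m (x + sqrt t * w) = cos_mode m x * cos (s * w) - sin (real m * pi * x) * sin (s * w)"
      by (simp add: cos_mode_def s_def cos_add[symmetric] algebra_simps)
    show "sqrt t * (heat_kernel t x (x + sqrt t * w) * cos_mode m (x + sqrt t * w)) =
        cos_mode m x * (std_normal_density w * cos (s * w))
                    - sin (real m * pi * x) * (std_normal_density w * sin (s * w))"
      unfolding mult.assoc[symmetric] 1 unfolding 2 by (simp add: algebra_simps)
  qed
  also have "\<dots> = cos_mode m x * exp (- (s\<^sup>2) / 2)"
    by (subst Bochner_Integration.integral_diff) (simp_all add: cosi sini cosI sinI)
  also have "- (s\<^sup>2) / 2 = - (cos_eig m * t)"
    using t by (simp add: s_def cos_eig_def power_mult_distrib)
  finally show "(LINT z|lborel. heat_kernel t x z * cos_mode m z) = exp (- (cos_eig m * t)) * cos_mode m x"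
    by simp
qed

section \<open>Convergence of the sum over images\<close>

definition image_decay :: "int \<Rightarrow> real" where
  "image_decay k = 1 / real_of_int (max 1 \<bar>k\<bar>) ^ 4"

lemma image_decay_pos: "image_decay k > 0"
  by (simp add: image_decay_def)

text \<open>The positive and the negative integers each give the series of n^(-4). The maximum with
  1 makes the value at 0 equal to 1, where division by zero would give 0 and spoil the
  majorant.\<close>

lemma summable_image_decay: "image_decay summable_on UNIV"
proof -
  have s: "(\<lambda>n::nat. inverse (real (Suc n) ^ 4)) summable_on UNIV"
    by (rule summable_nonneg_imp_summable_on)
       (auto simp del: of_nat_Suc intro!: summable_Suc_iff[THEN iffD2] inverse_power_summable)
  have "image_decay summable_on ((\<lambda>n. int (Suc n)) ` UNIV)" "image_decay summable_on ((\<lambda>n. - int (Suc n)) ` UNIV)"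
    by (subst summable_on_reindex, simp add: inj_on_def,
        rule summable_on_cong[THEN iffD2, OF _ s], simp add: image_decay_def inverse_eq_divide add.commute)+
  moreover have "image_decay summable_on {0}" by simp
  ultimately have "image_decay summable_on ((\<lambda>n. int (Suc n)) ` UNIV \<union> (\<lambda>n. - int (Suc n)) ` UNIV \<union> {0})"
    by (intro summable_on_union)
  moreover have "((\<lambda>n. int (Suc n)) ` UNIV \<union> (\<lambda>n. - int (Suc n)) ` UNIV \<union> {0}) = UNIV"
  proof (intro UNIV_eq_I[symmetric])
    fix k :: int
    show "k \<in> (\<lambda>n. int (Suc n)) ` UNIV \<union> (\<lambda>n. - int (Suc n)) ` UNIV \<union> {0}"
    proof (cases k "0::int" rule: linorder_cases)
      case less
      then have "k = - int (Suc (nat (- k - 1)))" by simp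
      then show ?thesis by blast
    next
      case greater
      then have "k = int (Suc (nat (k - 1)))" by simp
      then show ?thesis by blast
    qed simp
  qed
  ultimately show ?thesis by simp
qed

definition neum_image :: "real \<Rightarrow> real \<Rightarrow> real \<Rightarrow> int \<Rightarrow> real" where
  "neum_image t x y k = heat_kernel t x (y + 2 * of_int k) + heat_kernel t x (- y + 2 * of_int k)"

lemma neum_image_pos: "t > 0 \<Longrightarrow> neum_image t x y k > 0"
  by (simp add: neum_image_def add_pos_pos heat_kernel_pos)

lemma green_neum_eq: "green_neum t x y = (\<Sum>\<^sub>\<infinity>k. neum_image t x y k)"
  by (simp add: green_neum_def neum_image_def)

lemma neum_image_decay:
  assumes t: "t > 0" and d: "0 < d"
    and "\<And>s. s \<in> {y, - y} \<Longrightarrow> d * real_of_int (max 1 \<bar>k\<bar>) \<le> \<bar>x - (s + 2 * of_int k)\<bar>"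
  shows "neum_image t x y k \<le> 16 * t\<^sup>2 / sqrt (2 * pi * t) / d ^ 4 * image_decay k"
proof -
  have "heat_kernel t x (s + 2 * of_int k) \<le> 8 * t\<^sup>2 / sqrt (2 * pi * t) / d ^ 4 * image_decay k"
    if "s \<in> {y, - y}" for s
    using heat_kernel_decay[OF t _ assms(3)[OF that]] d
    by (simp add: image_decay_def power_mult_distrib)
  from this[of y] this[of "- y"] show ?thesis
    by (simp add: neum_image_def)
qed

text \<open>Since |x - s| \<le> 2, the distance is at least 2|k| - 2, and this is at least |k| once
  |k| >= 2.\<close>

lemma image_distance:
  fixes k :: int
  assumes "x \<in> {0..1}" "y \<in> {0..1}" "s \<in> {y, - y}" "\<bar>k\<bar> \<ge> 2"
  shows "real_of_int \<bar>k\<bar> \<le> \<bar>x - (s + 2 * of_int k)\<bar>"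
proof -
  have "k \<ge> 2 \<or> k \<le> -2" using assms by linarith
  then have "real_of_int k \<ge> 2 \<or> real_of_int k \<le> -2" by linarith
  then show ?thesis using assms(1-3) by auto
qed

text \<open>For |k| >= 2 the decay bound applies with d = 1. The three remaining indices may have
  images at distance 0 from \<open>x\<close>, so there the peak of the Gaussian is used. The
  constant dominates both bounds.\<close>

lemma neum_image_le:
  assumes t: "t > 0" and x: "x \<in> {0..1}" and y: "y \<in> {0..1}"
  shows "neum_image t x y k \<le> (16 * t\<^sup>2 + 2) / sqrt (2 * pi * t) * image_decay k"
proof (cases "\<bar>k\<bar> \<ge> 2")
  case True
  then have m: "max 1 \<bar>k\<bar> = \<bar>k\<bar>" by simp
  have "neum_image t x y k \<le> 16 * t\<^sup>2 / sqrt (2 * pi * t) / 1 ^ 4 * image_decay k"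
    by (rule neum_image_decay[OF t]) (use image_distance[OF x y _ True] m in auto)
  also have "\<dots> \<le> (16 * t\<^sup>2 + 2) / sqrt (2 * pi * t) * image_decay k"
    using t less_imp_le[OF image_decay_pos[of k]]
    by (intro mult_right_mono) (auto intro!: divide_right_mono)
  finally show ?thesis .
next
  case False
  then have "max 1 \<bar>k\<bar> = 1" by simp
  then have m: "image_decay k = 1" by (simp add: image_decay_def)
  have "neum_image t x y k \<le> 2 / sqrt (2 * pi * t)"
    using heat_kernel_le_peak[OF t, of x] unfolding neum_image_def
    by (smt (verit, best) add_divide_distrib)
  also have "\<dots> \<le> (16 * t\<^sup>2 + 2) / sqrt (2 * pi * t)"
    using t by (intro divide_right_mono) auto
  finally show ?thesis by (simp add: m)
qed

lemma uniform_limit_green_neum: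
  assumes t: "t > 0" and x: "x \<in> {0..1}"
  shows "uniform_limit {0..1} (\<lambda>X y. \<Sum>k\<in>X. neum_image t x y k) (green_neum t x) (finite_subsets_at_top UNIV)"
  unfolding green_neum_eq[abs_def]
proof (rule Weierstrass_m_test_general)
  show "norm (neum_image t x y k) \<le> (16 * t\<^sup>2 + 2) / sqrt (2 * pi * t) * image_decay k"
    if "y \<in> {0..1}" for k y
    using neum_image_le[OF t x that] neum_image_pos[OF t] by (simp add: abs_of_pos)
qed (intro summable_on_cmult_right summable_image_decay)

lemma summable_on_neum_image:
  assumes "t > 0" "x \<in> {0..1}" "y \<in> {0..1}"
  shows "neum_image t x y summable_on UNIV"
  by (rule summable_on_comparison_test[OF _ neum_image_le[OF assms]])
     (use assms in \<open>auto intro: less_imp_le neum_image_pos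
       simp del: times_divide_eq_left intro!: summable_on_cmult_right summable_image_decay\<close>)

lemma green_neum_pos:
  assumes "t > 0" "x \<in> {0..1}" "y \<in> {0..1}"
  shows "green_neum t x y > 0"
proof -
  have "(\<Sum>\<^sub>\<infinity>k\<in>{0}. neum_image t x y k) \<le> green_neum t x y"
    unfolding green_neum_eq
    by (rule infsum_mono_neutral)
       (auto intro!: less_imp_le[OF neum_image_pos] summable_on_neum_image assms)
  then show ?thesis
    using neum_image_pos[OF assms(1), of x y 0] by simp
qed

lemma continuous_on_neum_image [continuous_intros]:
  assumes "t > 0"
  shows "continuous_on S (\<lambda>y. neum_image t x y k)"
  unfolding neum_image_def using assms by (intro continuous_intros)

lemma continuous_on_green_neum:
  assumes "t > 0" "x \<in> {0..1}"
  shows "continuous_on {0..1} (green_neum t x)"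
  by (rule uniform_limit_theorem[OF _ uniform_limit_green_neum[OF assms]])
     (auto intro!: always_eventually continuous_intros assms)

section \<open>Diagonalisation of the Neumann kernel by cosines\<close>

lemma cos_mode_shift: "cos_mode m (y + 2 * of_int k) = cos_mode m y"
proof -
  have "real m * pi * (y + 2 * of_int k) = real m * pi * y + 2 * pi * of_int (int m * k)"
    by (simp add: algebra_simps)
  then show ?thesis
    unfolding cos_mode_def by (simp only: cos_add cos_int_2pin sin_int_2pin mult_1_right mult_zero_right diff_zero)
qed

lemma cos_mode_minus [simp]: "cos_mode m (- y) = cos_mode m y"
  by (simp add: cos_mode_def)

text \<open>As y runs over [0,1], y + 2k sweeps [2k, 2k+1] and -y + 2k sweeps [2k-1, 2k]. The mode
  is even and 2-periodic, so the two reflected pieces unfold into one full period on the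
  line.\<close>

lemma has_integral_neum_image_cos_mode:
  assumes t: "t > 0"
  shows "((\<lambda>y. neum_image t x y k * cos_mode m y) has_integral
           integral {2 * of_int k - 1..2 * of_int k + 1} (\<lambda>z. heat_kernel t x z * cos_mode m z)) {0..1}"
proof -
  let ?g = "\<lambda>z. heat_kernel t x z * cos_mode m z"
  let ?c = "2 * real_of_int k"
  have int: "?g integrable_on {a..b}" for a b
    using t by (intro integrable_continuous_interval continuous_intros)
  have "((?g \<circ> (+) ?c) has_integral integral {0 + ?c..1 + ?c} ?g) {0..1}"
    unfolding has_integral_shift_Icc_real by (rule integrable_integral[OF int])
  then have 1: "((\<lambda>y. ?g (y + ?c)) has_integral integral {?c..?c + 1} ?g) {0..1}"
    by (simp add: o_def add.commute[of _ ?c] add.commute[of 1])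
  have "((\<lambda>y. ?g ((-1) *\<^sub>R y + ?c)) has_integral (1 / (\<bar>-1\<bar> ^ DIM(real))) *\<^sub>R integral {?c - 1..?c} ?g)
      ((\<lambda>y. (1 / (-1)) *\<^sub>R y + - ((1 / (-1)) *\<^sub>R ?c)) ` cbox (?c - 1) ?c)"
    by (rule has_integral_affinity) (use integrable_integral[OF int] in auto)
  moreover have "(\<lambda>y::real. (1 / (-1)) *\<^sub>R y + - ((1 / (-1)) *\<^sub>R ?c)) ` cbox (?c - 1) ?c = {0..1}"
  proof -
    have "(\<lambda>y::real. (1 / (-1)) *\<^sub>R y + - ((1 / (-1)) *\<^sub>R ?c)) = (\<lambda>y. ?c - y)" by auto
    then show ?thesis by simp
  qed
  ultimately have 2: "((\<lambda>y. ?g (- y + ?c)) has_integral integral {?c - 1..?c} ?g) {0..1}"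
    by simp
  have "((\<lambda>y. ?g (y + ?c) + ?g (- y + ?c)) has_integral (integral {?c..?c + 1} ?g + integral {?c - 1..?c} ?g)) {0..1}"
    by (rule has_integral_add[OF 1 2])
  moreover have "integral {?c - 1..?c} ?g + integral {?c..?c + 1} ?g = integral {?c - 1..?c + 1} ?g"
    by (rule Henstock_Kurzweil_Integration.integral_combine) (auto intro: int)
  moreover have "?g (y + ?c) + ?g (- y + ?c) = neum_image t x y k * cos_mode m y" for y
    unfolding cos_mode_shift by (simp add: neum_image_def algebra_simps)
  ultimately show ?thesis by (simp add: add.commute)
qed

lemma sum_integral_periods:
  assumes f: "\<And>a b. f integrable_on {a..b::real}"
  shows "(\<Sum>k\<in>{- int N..int N}. integral {2 * real_of_int k - 1..2 * of_int k + 1} f :: real)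
           = integral {- (2 * real N + 1)..2 * real N + 1} f"
proof (induction N)
  case 0
  then show ?case by simp
next
  case (Suc N)
  have eq: "{- int (Suc N)..int (Suc N)} = insert (- int (Suc N)) (insert (int (Suc N)) {- int N..int N})"
    by auto
  have "(\<Sum>k\<in>{- int (Suc N)..int (Suc N)}. integral {2 * real_of_int k - 1..2 * of_int k + 1} f)
     = integral {- (2 * real N + 3)..- (2 * real N + 1)} f + (integral {2 * real N + 1..2 * real N + 3} f
        + integral {- (2 * real N + 1)..2 * real N + 1} f)"
    unfolding eq using Suc.IH by (simp add: algebra_simps)
  also have "\<dots> = integral {- (2 * real N + 3)..2 * real N + 3} f"
    using Henstock_Kurzweil_Integration.integral_combine[OF _ _ f, of "- (2 * real N + 3)" "- (2 * real N + 1)" "2 * real N + 1"]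
      Henstock_Kurzweil_Integration.integral_combine[OF _ _ f, of "- (2 * real N + 3)" "2 * real N + 1" "2 * real N + 3"]
    by simp
  also have "2 * real N + 3 = 2 * real (Suc N) + 1" by simp
  finally show ?case .
qed

text \<open>The periods belonging to different \<open>k\<close> tile the line, so the integral over
  [0,1] against the Neumann kernel becomes the Gaussian integral over the whole line.\<close>

lemma integral_green_neum_cos_mode:
  assumes t: "t > 0" and x: "x \<in> {0..1}"
  shows "integral {0..1} (\<lambda>y. green_neum t x y * cos_mode m y) = exp (- (cos_eig m * t)) * cos_mode m x"
proof -
  let ?g = "\<lambda>z. heat_kernel t x z * cos_mode m z"
  have lim: "uniform_limit {0..1} (\<lambda>X y. (\<Sum>k\<in>X. neum_image t x y k) * cos_mode m y)
      (\<lambda>y. green_neum t x y * cos_mode m y) (finite_subsets_at_top UNIV)"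
  proof (intro uniform_lim_mult uniform_limit_const uniform_limit_green_neum t x)
    show "bounded (green_neum t x ` {0..1})"
      using compact_continuous_image[OF continuous_on_green_neum[OF t x]] compact_imp_bounded by blast
    show "bounded (cos_mode m ` {0..1})"
      using abs_cos_mode_le_1 by (auto intro!: boundedI)
  qed
  obtain I J where IJ: "\<And>X. ((\<lambda>y. (\<Sum>k\<in>X. neum_image t x y k) * cos_mode m y) has_integral I X) {0..1}"
      "((\<lambda>y. green_neum t x y * cos_mode m y) has_integral J) {0..1}" "(I \<longlongrightarrow> J) (finite_subsets_at_top UNIV)"
    by (rule uniform_limit_integral[OF lim]) (use t in \<open>auto intro!: continuous_intros\<close>)
  \<comment> \<open>The infinite sum is a limit along finite index sets; the symmetric intervals
    eventually contain any finite set, so the limit may be computed along them.\<close>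
  have "filterlim (\<lambda>N. {- int N..int N}) (finite_subsets_at_top UNIV) sequentially"
    unfolding filterlim_finite_subsets_at_top
  proof safe
    fix X :: "int set" assume "finite X"
    then have B: "\<And>k. k \<in> X \<Longrightarrow> \<bar>k\<bar> \<le> Max (abs ` X)"
      by (intro Max_ge) auto
    have "\<forall>\<^sub>F N in sequentially. X \<subseteq> {- int N..int N}"
      using eventually_ge_at_top[of "nat (Max (abs ` X))"]
    proof eventually_elim
      case (elim N)
      show ?case
      proof
        fix k assume "k \<in> X"
        from B[OF this] elim have "\<bar>k\<bar> \<le> int N" by linarith
        then show "k \<in> {- int N..int N}" by auto
      qed
    qed
    then show "\<forall>\<^sub>F N in sequentially. finite {- int N..int N} \<and> X \<subseteq> {- int N..int N} \<and> {- int N..int N} \<subseteq> UNIV"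
      by simp
  qed
  from filterlim_compose[OF IJ(3) this] have lim1: "(\<lambda>N. I {- int N..int N}) \<longlonglongrightarrow> J" .
  have int: "integrable lborel ?g"
    by (rule lborel_integral_heat_kernel_cos_mode[OF t])
  have I: "I {- int N..int N} = (LINT z|lborel. indicator {- (2 * real N + 1)..2 * real N + 1} z *\<^sub>R ?g z)" for N
  proof -
    have "((\<lambda>y. \<Sum>k\<in>{- int N..int N}. neum_image t x y k * cos_mode m y) has_integral
        (\<Sum>k\<in>{- int N..int N}. integral {2 * real_of_int k - 1..2 * of_int k + 1} ?g)) {0..1}"
      by (intro has_integral_sum has_integral_neum_image_cos_mode t) auto
    then have "((\<lambda>y. (\<Sum>k\<in>{- int N..int N}. neum_image t x y k) * cos_mode m y) has_integral
        (\<Sum>k\<in>{- int N..int N}. integral {2 * real_of_int k - 1..2 * of_int k + 1} ?g)) {0..1}"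
      by (simp add: sum_distrib_right)
    with IJ(1) have "I {- int N..int N} = (\<Sum>k\<in>{- int N..int N}. integral {2 * real_of_int k - 1..2 * of_int k + 1} ?g)"
      by (rule has_integral_unique)
    also have "\<dots> = integral {- (2 * real N + 1)..2 * real N + 1} ?g"
      by (intro sum_integral_periods integrable_continuous_interval continuous_intros t)
    also have "\<dots> = (LINT z:{- (2 * real N + 1)..2 * real N + 1}|lborel. ?g z)"
    proof (rule set_borel_integral_eq_integral(2)[symmetric])
      show "set_integrable lborel {- (2 * real N + 1)..2 * real N + 1} ?g"
        unfolding set_integrable_def by (rule integrable_mult_indicator[OF _ int]) simp
    qed
    finally show ?thesis by (simp add: set_lebesgue_integral_def)
  qed
  have "(\<lambda>N. LINT z|lborel. indicator {- (2 * real N + 1)..2 * real N + 1} z *\<^sub>R ?g z) \<longlonglongrightarrow> (LINT z|lborel. ?g z)"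
  proof (rule integral_dominated_convergence[where w = "\<lambda>z. \<bar>?g z\<bar>"])
    show "AE z in lborel. (\<lambda>N. indicator {- (2 * real N + 1)..2 * real N + 1} z *\<^sub>R ?g z) \<longlonglongrightarrow> ?g z"
    proof (intro AE_I2 tendsto_eventually)
      fix z :: real
      show "\<forall>\<^sub>F N in sequentially. indicator {- (2 * real N + 1)..2 * real N + 1} z *\<^sub>R ?g z = ?g z"
        using eventually_ge_at_top[of "nat \<lceil>\<bar>z\<bar>\<rceil>"]
      proof eventually_elim
        case (elim N)
        then have "z \<in> {- (2 * real N + 1)..2 * real N + 1}" by (simp add: abs_le_iff)
        then show ?case by (simp only: indicator_simps scaleR_one)
      qed
    qed
    show "AE z in lborel. norm (indicator {- (2 * real N + 1)..2 * real N + 1} z *\<^sub>R ?g z) \<le> \<bar>?g z\<bar>" for N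
      by (auto simp: indicator_def)
    show "?g \<in> borel_measurable lborel"
      using int by (rule borel_measurable_integrable)
    then show "(\<lambda>z. indicator {- (2 * real N + 1)..2 * real N + 1} z *\<^sub>R ?g z) \<in> borel_measurable lborel" for N
      by (intro borel_measurable_scaleR borel_measurable_indicator) simp_all
    show "integrable lborel (\<lambda>z. \<bar>?g z\<bar>)"
      using int by (rule integrable_abs)
  qed
  with lim1 I have "J = (LINT z|lborel. ?g z)"
    using LIMSEQ_unique by simp
  then show ?thesis
    using IJ(2) lborel_integral_heat_kernel_cos_mode(2)[OF t] by (simp add: integral_unique)
qed

lemma summable_exp_cos_eig:
  assumes t: "t > 0"
  shows "summable (\<lambda>k. exp (- (cos_eig k * t)))"
proof (rule summable_comparison_test_ev)
  show "summable (\<lambda>k. (2 / (pi\<^sup>2 * t)) * inverse (real k ^ 2))"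
    by (intro summable_mult inverse_power_summable) auto
  show "\<forall>\<^sub>F k in sequentially. norm (exp (- (cos_eig k * t))) \<le> 2 / (pi\<^sup>2 * t) * inverse (real k ^ 2)"
    using eventually_gt_at_top[of 0]
  proof eventually_elim
    case (elim k)
    then have p: "cos_eig k * t > 0" using t by (simp add: cos_eig_def)
    have "exp (- (cos_eig k * t)) \<le> 1 / (cos_eig k * t)"
      using p order_trans[OF _ exp_ge_add_one_self[of "cos_eig k * t"]]
      by (simp add: exp_minus field_simps)
    then show ?case by (simp add: cos_eig_def power_mult_distrib field_simps)
  qed
qed

lemma green_neum_expansion:
  assumes t: "t > 0" and x: "x \<in> {0..1}" and y: "y \<in> {0..1}"
  shows "green_neum t x y = (\<Sum>k. cos_weight k * (exp (- (cos_eig k * t)) * cos_mode k x) * cos_mode k y)"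
proof (rule cos_series_expansion[OF continuous_on_green_neum[OF t x] integral_green_neum_cos_mode[OF t x] _ y])
  show "summable (\<lambda>k. \<bar>exp (- (cos_eig k * t)) * cos_mode k x\<bar>)"
    by (rule summable_comparison_test'[OF summable_exp_cos_eig[OF t], of 0])
       (auto simp: abs_mult intro!: mult_left_le abs_cos_mode_le_1)
qed

section \<open>Smallness of the kernel away from the diagonal\<close>

definition green_tail :: "real \<Rightarrow> real \<Rightarrow> real" where
  "green_tail d t = t\<^sup>2 / sqrt (2 * pi * t) * (16 * (\<Sum>\<^sub>\<infinity>k. image_decay k) / d ^ 4)"

lemma green_tail_nonneg: "t > 0 \<Longrightarrow> green_tail d t \<ge> 0"
  unfolding green_tail_def
  by (intro mult_nonneg_nonneg divide_nonneg_nonneg infsum_nonneg less_imp_le[OF image_decay_pos]) auto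

text \<open>The tail is a constant times t^(3/2). Dividing by \<open>t\<close> matters because the
  cut mass is itself of order \<delta>.\<close>

lemma green_tail_div_tendsto_0: "((\<lambda>t. green_tail d t / t) \<longlongrightarrow> 0) (at_right 0)"
proof -
  define c where "c = 16 * (\<Sum>\<^sub>\<infinity>k. image_decay k) / d ^ 4"
  have "((\<lambda>t::real. sqrt t * (c / sqrt (2 * pi))) \<longlongrightarrow> sqrt 0 * (c / sqrt (2 * pi))) (at_right 0)"
    by (intro tendsto_intros)
  moreover have "\<forall>\<^sub>F t::real in at_right 0. sqrt t * (c / sqrt (2 * pi)) = green_tail d t / t"
    using eventually_at_right_less[of 0]
  proof eventually_elim
    case (elim t)
    then have "t / sqrt (2 * pi * t) = sqrt t / sqrt (2 * pi)"
      by (simp add: real_sqrt_mult real_div_sqrt flip: divide_divide_eq_right)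
         (metis real_div_sqrt less_imp_le divide_divide_eq_left mult.commute)
    moreover have "green_tail d t / t = t / sqrt (2 * pi * t) * c"
      unfolding green_tail_def c_def[symmetric] using elim by (simp add: power2_eq_square)
    ultimately show ?case by simp
  qed
  ultimately have "((\<lambda>t. green_tail d t / t) \<longlongrightarrow> sqrt 0 * (c / sqrt (2 * pi))) (at_right 0)"
    by (rule Lim_transform_eventually)
  then show ?thesis by simp
qed

text \<open>The hypothesis \<open>d \<le> 1 - R\<close> handles reflection at the right end: the
  image 2 - y is at distance 2 - y - x >= 1 - R from \<open>x\<close>. All other images are at
  distance at least \<open>d\<close> as well.\<close>

lemma green_neum_off_diagonal:
  assumes t: "t > 0" and d: "0 < d" "R + d \<le> x" "d \<le> 1 - R" and x: "x \<le> 1" and y: "y \<in> {0..R}"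
  shows "green_neum t x y \<le> green_tail d t"
proof -
  have d1: "d \<le> 1" "x \<in> {0..1}" "y \<in> {0..1}" using d x y by auto
  have "neum_image t x y k \<le> 16 * t\<^sup>2 / sqrt (2 * pi * t) / d ^ 4 * image_decay k" for k
  proof (rule neum_image_decay[OF t d(1)])
    fix s assume s: "s \<in> {y, - y}"
    show "d * real_of_int (max 1 \<bar>k\<bar>) \<le> \<bar>x - (s + 2 * real_of_int k)\<bar>"
    proof (cases "\<bar>k\<bar> \<ge> 2")
      case True
      then have "max 1 \<bar>k\<bar> = \<bar>k\<bar>" by simp
      moreover have "d * real_of_int \<bar>k\<bar> \<le> 1 * real_of_int \<bar>k\<bar>"
        using d1 by (intro mult_right_mono) auto
      ultimately show ?thesis
        using image_distance[OF d1(2,3) s True] by simp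
    next
      case False
      then have "k = -1 \<or> k = 0 \<or> k = 1" by linarith
      then show ?thesis
        using s d x y by auto
    qed
  qed
  then have "green_neum t x y \<le> (\<Sum>\<^sub>\<infinity>k. 16 * t\<^sup>2 / sqrt (2 * pi * t) / d ^ 4 * image_decay k)"
    unfolding green_neum_eq
    by (intro infsum_mono summable_on_cmult_right summable_image_decay summable_on_neum_image t d1)
  also have "\<dots> = 16 * t\<^sup>2 / sqrt (2 * pi * t) / d ^ 4 * (\<Sum>\<^sub>\<infinity>k. image_decay k)"
    by (rule infsum_cmult_right[OF summable_image_decay])
  finally show ?thesis
    by (simp add: green_tail_def mult.assoc mult.left_commute)
qed

subsection \<open>Fixed profiles\<close>

locale fixed_profile =
  fixes j R \<delta> :: real and \<rho> :: "real \<Rightarrow> real"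
  assumes j_pos: "j > 0" and R: "0 < R" "R < 1" and \<delta>_pos: "\<delta> > 0"
    and profile: "is_fixed_profile j R \<delta> \<rho>"
begin

abbreviation u :: "real \<Rightarrow> real" where
  "u \<equiv> green_conv \<delta> (j * \<delta>) \<rho>"

text \<open>The total mass of j \<delta> D_0 + \<rho>; it turns out to be the mean of
  \<open>u\<close>, since the Neumann flow conserves mass.\<close>

definition mass :: real where
  "mass = j * \<delta> + integral {0..R} \<rho>"

definition cut_coeff :: "nat \<Rightarrow> real" where
  "cut_coeff k = integral {R..1} (\<lambda>x. u x * cos_mode k x)"

lemma \<rho>_cont: "continuous_on {0..R} \<rho>"
  and \<rho>_zero: "r \<in> {R<..1} \<Longrightarrow> \<rho> r = 0"
  and cut_mass: "integral {R..1} u = j * \<delta>"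
  and \<rho>_eq: "r \<in> {0..R} \<Longrightarrow> \<rho> r = u r"
  using profile by (auto simp: is_fixed_profile_def)

lemma u_eq: "u r = j * \<delta> * green_neum \<delta> r 0 + integral {0..R} (\<lambda>y. green_neum \<delta> r y * \<rho> y)"
proof -
  have "integral {0..1} (\<lambda>y. green_neum \<delta> r y * \<rho> y)
      = integral {0..1} (\<lambda>y. if y \<in> {0..R} then green_neum \<delta> r y * \<rho> y else 0)"
    by (rule integral_cong) (use \<rho>_zero in auto)
  also have "\<dots> = integral ({0..R} \<inter> {0..1}) (\<lambda>y. green_neum \<delta> r y * \<rho> y)"
    by (rule Henstock_Kurzweil_Integration.integral_restrict_Int)
  also have "{0..R} \<inter> {0..1} = {0..R}" using R by auto
  finally show ?thesis by (simp add: green_conv_def)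
qed

lemma green_cont: "r \<in> {0..1} \<Longrightarrow> continuous_on {0..R} (green_neum \<delta> r)"
  using continuous_on_green_neum[OF \<delta>_pos] R by (meson atLeastatMost_subset_iff continuous_on_subset less_imp_le order_refl)

text \<open>Minimum principle: suppose the minimum, attained at \<open>r\<close>, is negative. The
  kernel has mass at most 1 on [0,R], so averaging \<rho> against it gives at least \<rho>(r), and
  the source at 0 adds a strictly positive amount. Hence u(r) > \<rho>(r), contradicting the fixed
  point equation.\<close>

lemma \<rho>_nonneg: "\<forall>r\<in>{0..R}. \<rho> r \<ge> 0"
proof -
  obtain r where r: "r \<in> {0..R}" and min: "\<And>y. y \<in> {0..R} \<Longrightarrow> \<rho> r \<le> \<rho> y"
    using continuous_attains_inf[OF _ _ \<rho>_cont] R by auto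
  have r1: "r \<in> {0..1}" using r R by auto
  let ?p = "green_neum \<delta> r"
  have pnn: "?p y \<ge> 0" if "y \<in> {0..1}" for y
    using green_neum_pos[OF \<delta>_pos r1 that] by simp
  have "\<rho> r \<ge> 0"
  proof (rule ccontr)
    assume neg: "\<not> \<rho> r \<ge> 0"
    have "integral {0..R} ?p \<le> integral {0..1} ?p"
      by (rule integral_subset_le)
         (use R r1 pnn green_cont continuous_on_green_neum[OF \<delta>_pos] in \<open>auto intro!: integrable_continuous_interval\<close>)
    also have "\<dots> = 1"
      using integral_green_neum_cos_mode[OF \<delta>_pos r1, of 0] by simp
    finally have "\<rho> r * 1 \<le> \<rho> r * integral {0..R} ?p"
      using neg by (intro mult_left_mono_neg) auto
    also have "\<dots> = integral {0..R} (\<lambda>y. ?p y * \<rho> r)"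
      by (simp add: mult.commute)
    also have "\<dots> \<le> integral {0..R} (\<lambda>y. ?p y * \<rho> y)"
    proof (rule integral_le)
      show "?p y * \<rho> r \<le> ?p y * \<rho> y" if "y \<in> {0..R}" for y
        using min[OF that] pnn[of y] that R by (intro mult_left_mono) auto
    qed (intro integrable_continuous_interval continuous_intros green_cont r1 \<rho>_cont)+
    also have "\<dots> < u r"
      unfolding u_eq using j_pos \<delta>_pos green_neum_pos[OF \<delta>_pos r1, of 0] by simp
    finally show False
      using \<rho>_eq[OF r] by simp
  qed
  then show ?thesis using min by force
qed

text \<open>Taking y = 0 in the kernel bound covers the point source, so the bound multiplies the
  whole mass and not only that of \<rho>.\<close>

lemma u_le_mult_mass:
  assumes "r \<in> {0..1}" and "\<And>y. y \<in> {0..R} \<Longrightarrow> green_neum \<delta> r y \<le> K"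
  shows "u r \<le> K * mass"
proof -
  have "integral {0..R} (\<lambda>y. green_neum \<delta> r y * \<rho> y) \<le> integral {0..R} (\<lambda>y. K * \<rho> y)"
    by (rule integral_le)
       (use assms \<rho>_nonneg in \<open>auto intro!: integrable_continuous_interval continuous_intros green_cont \<rho>_cont mult_right_mono\<close>)
  moreover have "j * \<delta> * green_neum \<delta> r 0 \<le> j * \<delta> * K"
    using assms(2)[of 0] R j_pos \<delta>_pos by (intro mult_left_mono) auto
  ultimately show ?thesis
    unfolding u_eq mass_def by (simp add: algebra_simps)
qed

lemma u_nonneg: "r \<in> {0..1} \<Longrightarrow> u r \<ge> 0"
  unfolding u_eq using j_pos \<delta>_pos R green_neum_pos[OF \<delta>_pos, of r] \<rho>_nonneg
  by (intro add_nonneg_nonneg mult_nonneg_nonneg integral_nonneg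
      integrable_continuous_interval continuous_intros green_cont \<rho>_cont)
    (auto intro!: less_imp_le)

lemma mass_nonneg: "mass \<ge> 0"
  unfolding mass_def using j_pos \<delta>_pos \<rho>_nonneg
  by (intro add_nonneg_nonneg mult_nonneg_nonneg integral_nonneg
      integrable_continuous_interval \<rho>_cont) auto

section \<open>Cosine coefficients of the fixed point\<close>

definition \<rho>_coeff :: "nat \<Rightarrow> real" where
  "\<rho>_coeff k = integral {0..R} (\<lambda>y. cos_mode k y * \<rho> y)"

text \<open>The normalisation is included, so these are the coefficients in the series of
  \<open>u\<close> itself. The point source contributes j \<delta> to every mode because
  \<open>cos_mode k 0\<close> is 1.\<close>

definition u_coeff :: "nat \<Rightarrow> real" where
  "u_coeff k = cos_weight k * (exp (- (cos_eig k * \<delta>)) * (j * \<delta> + \<rho>_coeff k))"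

lemma mass_eq: "mass = u_coeff 0"
  by (simp add: mass_def u_coeff_def \<rho>_coeff_def cos_weight_def)

lemma abs_\<rho>_coeff_le: "\<bar>\<rho>_coeff k\<bar> \<le> integral {0..R} \<rho>"
proof -
  have "norm (\<rho>_coeff k) \<le> integral {0..R} \<rho>"
    unfolding \<rho>_coeff_def
  proof (rule integral_norm_bound_integral)
    fix y assume "y \<in> {0..R}"
    then show "norm (cos_mode k y * \<rho> y) \<le> \<rho> y"
      using \<rho>_nonneg abs_cos_mode_le_1[of k y] by (simp add: abs_mult mult_left_le_one_le)
  qed (intro integrable_continuous_interval continuous_intros \<rho>_cont)+
  then show ?thesis by simp
qed

lemma summable_u_coeff: "summable (\<lambda>k. \<bar>u_coeff k\<bar>)"
proof (rule summable_comparison_test'[of "\<lambda>k. 2 * mass * exp (- (cos_eig k * \<delta>))" 0])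
  show "summable (\<lambda>k. 2 * mass * exp (- (cos_eig k * \<delta>)))"
    by (intro summable_mult summable_exp_cos_eig \<delta>_pos)
  fix k
  have "\<bar>j * \<delta> + \<rho>_coeff k\<bar> \<le> mass"
    using abs_\<rho>_coeff_le[of k] j_pos \<delta>_pos unfolding mass_def
    by (smt (verit) mult_pos_pos)
  then show "norm \<bar>u_coeff k\<bar> \<le> 2 * mass * exp (- (cos_eig k * \<delta>))"
    unfolding u_coeff_def using mass_nonneg
    by (auto simp: abs_mult cos_weight_def)
qed

lemma u_series:
  assumes r: "r \<in> {0..1}"
  shows "u r = (\<Sum>k. u_coeff k * cos_mode k r)"
proof -
  let ?e = "\<lambda>k. exp (- (cos_eig k * \<delta>))"
  let ?c = "\<lambda>k. cos_weight k * (?e k * cos_mode k r)"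
  have sc: "summable (\<lambda>k. \<bar>?c k\<bar>)"
  proof (rule summable_comparison_test'[OF summable_mult[OF summable_exp_cos_eig[OF \<delta>_pos], of 2], of 0])
    show "norm \<bar>?c k\<bar> \<le> 2 * ?e k" for k
      using mult_left_le[OF abs_cos_mode_le_1[of k r], of "?e k"] by (simp add: abs_mult cos_weight_def)
  qed
  have "(\<lambda>k. ?c k * \<rho>_coeff k) sums integral {0..R} (\<lambda>y. (\<Sum>k. ?c k * cos_mode k y) * \<rho> y)"
    unfolding \<rho>_coeff_def by (rule sums_integral_cos_series[OF sc \<rho>_cont])
  also have "integral {0..R} (\<lambda>y. (\<Sum>k. ?c k * cos_mode k y) * \<rho> y) = integral {0..R} (\<lambda>y. green_neum \<delta> r y * \<rho> y)"
    by (rule integral_cong) (use R in \<open>simp add: green_neum_expansion[OF \<delta>_pos r]\<close>)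
  finally have 1: "(\<lambda>k. ?c k * \<rho>_coeff k) sums integral {0..R} (\<lambda>y. green_neum \<delta> r y * \<rho> y)" .
  have "(\<lambda>k. ?c k * cos_mode k 0) sums green_neum \<delta> r 0"
    using summable_sums[OF summable_cos_series[OF sc, of 0]] green_neum_expansion[OF \<delta>_pos r, of 0] by simp
  from sums_add[OF sums_mult[OF this, of "j * \<delta>"] 1]
  have "(\<lambda>k. u_coeff k * cos_mode k r) sums u r"
    unfolding u_eq by (simp add: u_coeff_def cos_mode_def[of _ 0] algebra_simps)
  then show ?thesis by (simp add: sums_iff)
qed

lemma u_cont: "continuous_on {0..1} u"
  using continuous_on_cos_series[OF summable_u_coeff, of "{0..1}"]
  by (rule continuous_on_eq) (simp add: u_series)

lemma u_cont': "continuous_on {R..1} u"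
  using u_cont by (rule continuous_on_subset) (use R in auto)

lemma abs_cut_coeff_le: "\<bar>cut_coeff k\<bar> \<le> j * \<delta>"
proof -
  have "norm (cut_coeff k) \<le> integral {R..1} u"
    unfolding cut_coeff_def
  proof (rule integral_norm_bound_integral)
    fix y assume "y \<in> {R..1}"
    then show "norm (u y * cos_mode k y) \<le> u y"
      using u_nonneg[of y] R abs_cos_mode_le_1[of k y] by (simp add: abs_mult mult_left_le)
  qed (intro integrable_continuous_interval continuous_intros u_cont')+
  then show ?thesis by (simp add: cut_mass)
qed

text \<open>Integrating \<open>u\<close> against the mode and splitting at \<open>R\<close> gives
  the two terms, as \<open>u\<close> coincides with \<rho> on [0,R].\<close>

lemma coeff_balance: "u_coeff k / cos_weight k = \<rho>_coeff k + cut_coeff k"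
proof -
  have "u_coeff k / cos_weight k = integral {0..1} (\<lambda>x. (\<Sum>k. u_coeff k * cos_mode k x) * cos_mode k x)"
    by (simp add: integral_cos_series_cos_mode[OF summable_u_coeff])
  also have "\<dots> = integral {0..1} (\<lambda>x. u x * cos_mode k x)"
    by (rule integral_cong) (simp add: u_series)
  also have "\<dots> = integral {0..R} (\<lambda>x. u x * cos_mode k x) + cut_coeff k"
    unfolding cut_coeff_def
    by (rule Henstock_Kurzweil_Integration.integral_combine[symmetric])
       (use R in \<open>auto intro!: integrable_continuous_interval continuous_intros u_cont\<close>)
  also have "integral {0..R} (\<lambda>x. u x * cos_mode k x) = \<rho>_coeff k"
    unfolding \<rho>_coeff_def by (rule integral_cong) (simp add: \<rho>_eq mult.commute)
  finally show ?thesis .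
qed

text \<open>The heat flow and \<open>coeff_balance\<close> give two expressions for the same
  coefficient; eliminating \<open>\<rho>_coeff k\<close> leaves only the cut part. For k = 0 the two
  relations leave the mean undetermined, so it has to be found by other means.\<close>

lemma u_coeff_eq:
  assumes k: "k > 0"
  shows "u_coeff k = 2 * (j - cut_coeff k / \<delta>) * (\<delta> / (exp (cos_eig k * \<delta>) - 1))"
proof -
  let ?e = "exp (cos_eig k * \<delta>)"
  have e: "?e > 1" using cos_eig_pos[OF k] \<delta>_pos by simp
  have "exp (- (cos_eig k * \<delta>)) * (j * \<delta> + \<rho>_coeff k) = \<rho>_coeff k + cut_coeff k"
    using coeff_balance[of k] less_imp_le[OF cos_weight_pos[of k]]
    by (simp add: u_coeff_def cos_weight_def split: if_splits)
  then have 1: "j * \<delta> + \<rho>_coeff k = ?e * (\<rho>_coeff k + cut_coeff k)"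
    by (simp add: exp_minus field_simps)
  then have 2: "(?e - 1) * (\<rho>_coeff k + cut_coeff k) = j * \<delta> - cut_coeff k"
    by (simp add: algebra_simps)
  have "u_coeff k = 2 * (\<rho>_coeff k + cut_coeff k)"
    using coeff_balance[of k] k by (simp add: cos_weight_def)
  also have "\<rho>_coeff k + cut_coeff k = (j * \<delta> - cut_coeff k) / (?e - 1)"
  proof (rule eq_divide_imp)
    show "?e - 1 \<noteq> 0" using e by linarith
    show "(\<rho>_coeff k + cut_coeff k) * (?e - 1) = j * \<delta> - cut_coeff k"
      using 2 by (simp only: mult.commute)
  qed
  also have "j * \<delta> - cut_coeff k = (j - cut_coeff k / \<delta>) * \<delta>"
    using \<delta>_pos by (simp add: left_diff_distrib)
  finally show ?thesis by simp
qed

text \<open>From exp x - 1 >= x the last factor is at most \<open>1 / cos_eig k\<close>, and the cut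
  part, being nonnegative of mass j \<delta>, has coefficients at most j \<delta>. The bound is free
  of \<delta> and summable.\<close>

lemma abs_u_coeff_le:
  assumes k: "k > 0"
  shows "\<bar>u_coeff k\<bar> \<le> 4 * j / cos_eig k"
proof -
  have a: "cos_eig k > 0" by (rule cos_eig_pos[OF k])
  have "cos_eig k * \<delta> \<le> exp (cos_eig k * \<delta>) - 1"
    using exp_ge_add_one_self[of "cos_eig k * \<delta>"] by linarith
  moreover have "0 < cos_eig k * \<delta>" using a \<delta>_pos by simp
  ultimately have "\<delta> / (exp (cos_eig k * \<delta>) - 1) \<le> \<delta> / (cos_eig k * \<delta>)"
    using \<delta>_pos by (intro frac_le) auto
  then have 1: "\<delta> / (exp (cos_eig k * \<delta>) - 1) \<le> 1 / cos_eig k"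
    using \<delta>_pos by simp
  have nn: "0 \<le> \<delta> / (exp (cos_eig k * \<delta>) - 1)"
    using a \<delta>_pos by simp
  have "\<bar>cut_coeff k / \<delta>\<bar> \<le> j"
    using abs_cut_coeff_le[of k] \<delta>_pos by (simp add: field_simps abs_divide)
  then have "\<bar>j - cut_coeff k / \<delta>\<bar> \<le> 2 * j"
    by linarith
  then have "2 * \<bar>j - cut_coeff k / \<delta>\<bar> * (\<delta> / (exp (cos_eig k * \<delta>) - 1)) \<le> 2 * (2 * j) * (1 / cos_eig k)"
    using 1 nn j_pos by (intro mult_mono) auto
  then show ?thesis
    unfolding u_coeff_eq[OF k] abs_mult abs_of_nonneg[OF nn] by simp
qed

section \<open>Uniform bound on the mean and concentration of the cut part at R\<close>

lemma u_split:
  assumes "r \<in> {0..1}"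
  shows "u r - mass = (\<Sum>k. u_coeff (Suc k) * cos_mode (Suc k) r)"
  using suminf_split_head[OF summable_cos_series[OF summable_u_coeff, of r]]
  by (simp add: u_series[OF assms] mass_eq)

text \<open>The nonconstant modes are bounded by the series, so \<open>u\<close> stays above the
  mean minus that bound. Integrating over [R,1], where \<open>u\<close> has mass only j \<delta>,
  bounds the mean.\<close>

lemma mass_le: "mass \<le> (\<Sum>k. 4 * j * (1 / cos_eig (Suc k))) + j * \<delta> / (1 - R)"
proof -
  let ?B = "\<Sum>k. 4 * j * (1 / cos_eig (Suc k))"
  have "mass - ?B \<le> u r" if r: "r \<in> {0..1}" for r
  proof -
    have "\<bar>\<Sum>k. u_coeff (Suc k) * cos_mode (Suc k) r\<bar> \<le> ?B"
      unfolding real_norm_def[symmetric]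
    proof (rule norm_suminf_le)
      show "summable (\<lambda>k. 4 * j * (1 / cos_eig (Suc k)))"
        by (intro summable_mult summable_inverse_cos_eig)
      show "norm (u_coeff (Suc k) * cos_mode (Suc k) r) \<le> 4 * j * (1 / cos_eig (Suc k))" for k
        using abs_u_coeff_le[of "Suc k"] mult_left_le[OF abs_cos_mode_le_1[of "Suc k" r], of "\<bar>u_coeff (Suc k)\<bar>"]
        by (simp add: abs_mult)
    qed
    then show ?thesis using u_split[OF r] by linarith
  qed
  then have "integral {R..1} (\<lambda>_. mass - ?B) \<le> integral {R..1} u"
    by (intro integral_le integrable_continuous_interval continuous_intros u_cont') (use R in auto)
  then have "(1 - R) * (mass - ?B) \<le> j * \<delta>"
    using R by (simp add: cut_mass)
  then show ?thesis
    using R by (simp add: field_simps)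
qed

lemma u_tail:
  assumes "0 < d" "d \<le> 1 - R" "R + d \<le> r" "r \<le> 1"
  shows "u r \<le> green_tail d \<delta> * mass"
proof (rule u_le_mult_mass)
  show "r \<in> {0..1}" using assms R by auto
  fix y assume "y \<in> {0..R}"
  then show "green_neum \<delta> r y \<le> green_tail d \<delta>"
    by (rule green_neum_off_diagonal[OF \<delta>_pos assms(1,3,2,4)])
qed

text \<open>Within distance \<open>d\<close> of \<open>R\<close> the mode varies by at most k pi d,
  and \<open>u\<close> has mass at most j \<delta> there. Farther away the mode varies by at most 2
  and \<open>u\<close> is bounded by \<open>u_tail\<close>. Division by \<delta> gives the two error
  terms.\<close>

lemma cut_coeff_close:
  assumes d: "0 < d" "d \<le> 1 - R"
  shows "\<bar>cut_coeff k / \<delta> - j * cos_mode k R\<bar> \<le> j * (real k * pi) * d + 2 * (green_tail d \<delta> / \<delta>) * mass"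
proof -
  let ?T = "green_tail d \<delta> * mass"
  have T: "?T \<ge> 0" using green_tail_nonneg[OF \<delta>_pos] mass_nonneg by simp
  have "integral {R..1} (\<lambda>x. u x * (cos_mode k x - cos_mode k R)) = cut_coeff k - integral {R..1} (\<lambda>x. u x * cos_mode k R)"
    unfolding cut_coeff_def right_diff_distrib
    by (intro integral_diff integrable_continuous_interval continuous_intros u_cont')
  then have eq: "cut_coeff k - j * \<delta> * cos_mode k R = integral {R..1} (\<lambda>x. u x * (cos_mode k x - cos_mode k R))"
    by (simp add: cut_mass)
  have "norm (integral {R..1} (\<lambda>x. u x * (cos_mode k x - cos_mode k R)))
      \<le> integral {R..1} (\<lambda>x. u x * (real k * pi * d) + 2 * ?T)"
  proof (rule integral_norm_bound_integral)
    fix x assume x: "x \<in> {R..1}"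
    have u: "u x \<ge> 0" using u_nonneg[of x] x R by simp
    show "norm (u x * (cos_mode k x - cos_mode k R)) \<le> u x * (real k * pi * d) + 2 * ?T"
    proof (cases "x \<le> R + d")
      case True
      have "\<bar>cos_mode k x - cos_mode k R\<bar> \<le> real k * pi * \<bar>x - R\<bar>"
        by (rule abs_cos_mode_diff_le)
      also have "\<dots> \<le> real k * pi * d"
        using True x by (intro mult_left_mono) auto
      finally have "u x * \<bar>cos_mode k x - cos_mode k R\<bar> \<le> u x * (real k * pi * d)"
        using u by (intro mult_left_mono)
      then show ?thesis using T u by (simp add: abs_mult)
    next
      case False
      have "\<bar>cos_mode k x - cos_mode k R\<bar> \<le> 2"
        using abs_cos_mode_le_1[of k x] abs_cos_mode_le_1[of k R] by linarith
      moreover have "u x \<le> ?T" using u_tail[OF d, of x] False x by simp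
      ultimately have "u x * \<bar>cos_mode k x - cos_mode k R\<bar> \<le> ?T * 2"
        using T by (intro mult_mono) auto
      moreover have "0 \<le> u x * (real k * pi * d)" using u d by simp
      ultimately show ?thesis using u by (simp add: abs_mult)
    qed
  qed (intro integrable_continuous_interval continuous_intros u_cont')+
  also have "\<dots> = integral {R..1} (\<lambda>x. u x * (real k * pi * d)) + integral {R..1} (\<lambda>x. 2 * ?T)"
    by (intro integral_add integrable_continuous_interval continuous_intros u_cont')
  also have "\<dots> = j * \<delta> * (real k * pi * d) + 2 * ?T * (1 - R)"
    using R by (simp add: cut_mass)
  also have "\<dots> \<le> j * \<delta> * (real k * pi * d) + 2 * ?T"
    using T R by (simp add: mult_left_le)
  finally have "\<bar>cut_coeff k - j * \<delta> * cos_mode k R\<bar> \<le> j * \<delta> * (real k * pi * d) + 2 * ?T"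
    by (simp add: eq)
  then have "\<bar>cut_coeff k - j * \<delta> * cos_mode k R\<bar> / \<delta> \<le> (j * \<delta> * (real k * pi * d) + 2 * ?T) / \<delta>"
    using \<delta>_pos by (intro divide_right_mono) auto
  moreover have "\<bar>cut_coeff k - j * \<delta> * cos_mode k R\<bar> / \<delta> = \<bar>cut_coeff k / \<delta> - j * cos_mode k R\<bar>"
    using \<delta>_pos by (simp add: abs_divide[symmetric, of _ \<delta>, simplified abs_of_pos[OF \<delta>_pos]] diff_divide_distrib)
  moreover have "(j * \<delta> * (real k * pi * d) + 2 * ?T) / \<delta> = j * (real k * pi) * d + 2 * (green_tail d \<delta> / \<delta>) * mass"
    using \<delta>_pos by (simp add: field_simps)
  ultimately show ?thesis by simp
qed

end

subsection \<open>The limit\<close>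

text \<open>The quotient is the reciprocal of the difference quotient of exp (a t) at 0, whose limit
  is \<open>a\<close>.\<close>

lemma exp_quotient_tendsto:
  assumes "a > 0"
  shows "((\<lambda>t::real. t / (exp (a * t) - 1)) \<longlongrightarrow> 1 / a) (at_right 0)"
proof -
  have "((\<lambda>t. exp (a * t)) has_real_derivative exp (a * 0) * a) (at 0)"
    by (auto intro!: derivative_eq_intros)
  then have "((\<lambda>t. (exp (a * t) - 1) / t) \<longlongrightarrow> a) (at 0)"
    by (simp add: has_field_derivative_iff)
  then have "((\<lambda>t. inverse ((exp (a * t) - 1) / t)) \<longlongrightarrow> inverse a) (at 0)"
    using assms by (intro tendsto_inverse) auto
  then have "((\<lambda>t. t / (exp (a * t) - 1)) \<longlongrightarrow> 1 / a) (at 0)"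
    by (simp add: inverse_eq_divide)
  then show ?thesis
    by (rule filterlim_mono) (auto simp: at_within_le_at)
qed

theorem theorem3p3:
  fixes j R :: real and \<rho> :: "real \<Rightarrow> real \<Rightarrow> real"
  assumes "j > 0" and "0 < R" and "R < 1"
    and "\<forall>\<^sub>F \<delta> in at_right 0. is_fixed_profile j R \<delta> (\<rho> \<delta>)"
  shows "\<forall>r\<in>{0..R}. ((\<lambda>\<delta>. \<rho> \<delta> r) \<longlongrightarrow> 2 * j * (R - r)) (at_right 0)"
proof
  fix r assume r: "r \<in> {0..R}"
  note jR = assms(1-3)
  let ?u = "\<lambda>\<delta>. green_conv \<delta> (j * \<delta>) (\<rho> \<delta>)"
  let ?m = "\<lambda>\<delta>. fixed_profile.mass j R \<delta> (\<rho> \<delta>)"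
  let ?v = "\<lambda>\<delta>. fixed_profile.cut_coeff j R \<delta> (\<rho> \<delta>)"
  let ?c = "\<lambda>\<delta>. fixed_profile.u_coeff j R \<delta> (\<rho> \<delta>)"
  define B where "B = (\<Sum>k. 4 * j * (1 / cos_eig (Suc k)))"
  have fp: "\<forall>\<^sub>F \<delta> in at_right 0. fixed_profile j R \<delta> (\<rho> \<delta>)"
    using assms(4) eventually_at_right_less[of 0]
    by eventually_elim (use jR in \<open>auto intro: fixed_profile.intro\<close>)
  \<comment> \<open>The tail is o(\<delta>), while \<open>mass_le\<close> keeps the mass bounded as
    \<delta> tends to 0.\<close>
  have tail: "((\<lambda>\<delta>. green_tail d \<delta> / \<delta> * ?m \<delta>) \<longlongrightarrow> 0) (at_right 0)" for d
  proof (rule tendsto_sandwich[OF _ _ tendsto_const])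
    have "((\<lambda>\<delta>. green_tail d \<delta> / \<delta> * (B + j * \<delta> / (1 - R))) \<longlongrightarrow> 0 * (B + j * 0 / (1 - R))) (at_right 0)"
      by (intro tendsto_intros green_tail_div_tendsto_0) (use jR in auto)
    then show "((\<lambda>\<delta>. green_tail d \<delta> / \<delta> * (B + j * \<delta> / (1 - R))) \<longlongrightarrow> 0) (at_right 0)"
      by simp
    show "\<forall>\<^sub>F \<delta> in at_right 0. green_tail d \<delta> / \<delta> * ?m \<delta> \<le> green_tail d \<delta> / \<delta> * (B + j * \<delta> / (1 - R))"
      using fp eventually_at_right_less[of 0]
    proof eventually_elim
      case (elim \<delta>)
      then show ?case
        using fixed_profile.mass_le[OF elim(1)] green_tail_nonneg[of \<delta> d]
        unfolding B_def by (intro mult_left_mono) auto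
    qed
    show "\<forall>\<^sub>F \<delta> in at_right 0. 0 \<le> green_tail d \<delta> / \<delta> * ?m \<delta>"
      using fp eventually_at_right_less[of 0]
      by eventually_elim (use fixed_profile.mass_nonneg green_tail_nonneg in \<open>auto intro!: mult_nonneg_nonneg\<close>)
  qed
  have cut: "((\<lambda>\<delta>. ?v \<delta> k / \<delta>) \<longlongrightarrow> j * cos_mode k R) (at_right 0)" for k
  proof (rule tendstoI)
    fix e :: real assume e: "e > 0"
    \<comment> \<open>Fixed before \<delta> so that the Lipschitz error is at most e / 2; the tail
      error is then made small by \<delta>. The added 1 keeps the denominator positive for k = 0,
      and the minimum with 1 - R meets the hypothesis of \<open>cut_coeff_close\<close>.\<close>
    define d where "d = min (1 - R) (e / (2 * (j * (real k * pi) + 1)))"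
    have p: "j * (real k * pi) \<ge> 0" using jR by simp
    have "0 < e / (2 * (j * (real k * pi) + 1))"
      using e p by (intro divide_pos_pos mult_pos_pos add_nonneg_pos) auto
    then have d: "0 < d" "d \<le> 1 - R" using jR by (auto simp: d_def)
    have "d \<le> e / (2 * (j * (real k * pi) + 1))" by (simp add: d_def)
    then have "(j * (real k * pi) + 1) * d \<le> e / 2"
      using p by (simp add: field_simps)
    then have de: "j * (real k * pi) * d \<le> e / 2"
      using d by (simp add: algebra_simps)
    have "((\<lambda>\<delta>. 2 * (green_tail d \<delta> / \<delta> * ?m \<delta>)) \<longlongrightarrow> 2 * 0) (at_right 0)"
      by (intro tendsto_intros tail)
    then have "\<forall>\<^sub>F \<delta> in at_right 0. 2 * (green_tail d \<delta> / \<delta> * ?m \<delta>) < e / 2"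
      using e by (intro order_tendstoD(2)[where y = 0]) auto
    with fp show "\<forall>\<^sub>F \<delta> in at_right 0. dist (?v \<delta> k / \<delta>) (j * cos_mode k R) < e"
    proof eventually_elim
      case (elim \<delta>)
      show ?case
        using fixed_profile.cut_coeff_close[OF elim(1) d, of k] elim(2) de
        by (simp add: dist_real_def mult.assoc)
    qed
  qed
  have lim: "((\<lambda>\<delta>. ?u \<delta> x - ?m \<delta>) \<longlongrightarrow> j * (2 * max (R - x) 0 - R\<^sup>2)) (at_right 0)"
    if x: "x \<in> {0..1}" for x
  proof -
    let ?a = "\<lambda>k \<delta>. 2 * (j - ?v \<delta> (Suc k) / \<delta>) * (\<delta> / (exp (cos_eig (Suc k) * \<delta>) - 1)) * cos_mode (Suc k) x"
    let ?b = "\<lambda>k. j * (2 * ((1 - cos_mode (Suc k) R) / cos_eig (Suc k)) * cos_mode (Suc k) x)"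
    \<comment> \<open>Dominated convergence for series: each term converges by \<open>cut\<close>
      and \<open>exp_quotient_tendsto\<close>, and the majorant is the \<delta>-free bound of
      \<open>abs_u_coeff_le\<close>.\<close>
    have "((\<lambda>\<delta>. \<Sum>k. ?a k \<delta>) \<longlongrightarrow> (\<Sum>k. ?b k)) (at_right 0)"
    proof (rule tannerys_theorem[THEN conjunct2, THEN conjunct2])
      show "(?a k \<longlongrightarrow> ?b k) (at_right 0)" for k
      proof -
        have "(?a k \<longlongrightarrow> 2 * (j - j * cos_mode (Suc k) R) * (1 / cos_eig (Suc k)) * cos_mode (Suc k) x) (at_right 0)"
          by (intro tendsto_intros cut exp_quotient_tendsto cos_eig_pos) simp
        also have "2 * (j - j * cos_mode (Suc k) R) * (1 / cos_eig (Suc k)) * cos_mode (Suc k) x = ?b k"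
          by (simp add: algebra_simps diff_divide_distrib)
        finally show ?thesis .
      qed
      have "\<forall>\<^sub>F \<delta> in at_right 0. \<forall>k. norm (?a k \<delta>) \<le> 4 * j * (1 / cos_eig (Suc k))"
        using fp
      proof eventually_elim
        case (elim \<delta>)
        interpret fixed_profile j R \<delta> "\<rho> \<delta>" by fact
        show ?case
        proof
          fix k
          have "norm (?a k \<delta>) = \<bar>u_coeff (Suc k)\<bar> * \<bar>cos_mode (Suc k) x\<bar>"
            by (simp add: u_coeff_eq abs_mult)
          also have "\<dots> \<le> \<bar>u_coeff (Suc k)\<bar>"
            by (intro mult_left_le abs_cos_mode_le_1) auto
          also have "\<dots> \<le> 4 * j * (1 / cos_eig (Suc k))"
            using abs_u_coeff_le[of "Suc k"] by simp
          finally show "norm (?a k \<delta>) \<le> 4 * j * (1 / cos_eig (Suc k))" .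
        qed
      qed
      then show "\<forall>\<^sub>F (k, \<delta>) in at_top \<times>\<^sub>F at_right 0. norm (?a k \<delta>) \<le> 4 * j * (1 / cos_eig (Suc k))"
        unfolding eventually_prod_filter
        by (intro exI[of _ "\<lambda>_. True"] exI) auto
      show "summable (\<lambda>k. 4 * j * (1 / cos_eig (Suc k)))"
        by (intro summable_mult summable_inverse_cos_eig)
    qed simp
    moreover have "\<forall>\<^sub>F \<delta> in at_right 0. (\<Sum>k. ?a k \<delta>) = ?u \<delta> x - ?m \<delta>"
      using fp
    proof eventually_elim
      case (elim \<delta>)
      then show ?case
        using fixed_profile.u_split[OF elim x] by (simp add: fixed_profile.u_coeff_eq)
    qed
    ultimately have "((\<lambda>\<delta>. ?u \<delta> x - ?m \<delta>) \<longlongrightarrow> (\<Sum>k. ?b k)) (at_right 0)"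
      by (rule Lim_transform_eventually)
    also have "(\<Sum>k. ?b k) = j * (\<Sum>k. 2 * ((1 - cos_mode (Suc k) R) / cos_eig (Suc k)) * cos_mode (Suc k) x)"
      using sums_summable[OF tent_cos_series[OF jR(2,3) x]] by (rule suminf_mult)
    also have "\<dots> = j * (2 * max (R - x) 0 - R\<^sup>2)"
      by (simp only: sums_unique[OF tent_cos_series[OF jR(2,3) x], symmetric])
    finally show ?thesis .
  qed
  \<comment> \<open>The point 1 lies at distance 1 - R from [0,R], so \<open>u_tail\<close> applies
    with d = 1 - R; the factor \<delta> is split off to reuse \<open>tail\<close>.\<close>
  have u1: "((\<lambda>\<delta>. ?u \<delta> 1) \<longlongrightarrow> 0) (at_right 0)"
  proof (rule tendsto_sandwich[OF _ _ tendsto_const])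
    have "((\<lambda>\<delta>. \<delta> * (green_tail (1 - R) \<delta> / \<delta> * ?m \<delta>)) \<longlongrightarrow> 0 * 0) (at_right 0)"
      by (intro tendsto_intros tail)
    then show "((\<lambda>\<delta>. \<delta> * (green_tail (1 - R) \<delta> / \<delta> * ?m \<delta>)) \<longlongrightarrow> 0) (at_right 0)" by simp
    show "\<forall>\<^sub>F \<delta> in at_right 0. ?u \<delta> 1 \<le> \<delta> * (green_tail (1 - R) \<delta> / \<delta> * ?m \<delta>)"
      using fp eventually_at_right_less[of 0]
      by eventually_elim (use jR fixed_profile.u_tail[of j R _ _ "1 - R" 1] in auto)
    show "\<forall>\<^sub>F \<delta> in at_right 0. 0 \<le> ?u \<delta> 1"
      using fp by eventually_elim (use fixed_profile.u_nonneg in auto)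
  qed
  have r1: "r \<in> {0..1}" using r jR by auto
  \<comment> \<open>Comparing the points r and 1 cancels the mean, and the known limit at 1 then
    fixes the additive constant.\<close>
  have "((\<lambda>\<delta>. (?u \<delta> r - ?m \<delta>) - (?u \<delta> 1 - ?m \<delta>) + ?u \<delta> 1) \<longlongrightarrow>
      j * (2 * max (R - r) 0 - R\<^sup>2) - j * (2 * max (R - 1) 0 - R\<^sup>2) + 0) (at_right 0)"
    by (intro tendsto_intros lim u1 r1) simp
  moreover have "j * (2 * max (R - r) 0 - R\<^sup>2) - j * (2 * max (R - 1) 0 - R\<^sup>2) + 0 = 2 * j * (R - r)"
    using r jR by (simp add: max_def algebra_simps)
  ultimately have "((\<lambda>\<delta>. ?u \<delta> r) \<longlongrightarrow> 2 * j * (R - r)) (at_right 0)"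
    by simp
  moreover have "\<forall>\<^sub>F \<delta> in at_right 0. ?u \<delta> r = \<rho> \<delta> r"
    using fp by eventually_elim (use fixed_profile.\<rho>_eq r in auto)
  ultimately show "((\<lambda>\<delta>. \<rho> \<delta> r) \<longlongrightarrow> 2 * j * (R - r)) (at_right 0)"
    by (rule Lim_transform_eventually)
qed

end
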